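(* For all $\zeta \in \mathbb{T}$, the C$^*$-algebra $C^*(\mathcal{F}_{\zeta})$ equals $C^*((\mathcal{F}_{\zeta} \setminus \mathbb{P}_{\zeta}), \mathcal{K})$, the unital C$^*$-algebra generated by $\mathcal{K}$ and the collection of all composition operators $C_\varphi$ induced by linear-fractional, non-automorphism self-maps $\varphi$ of $\mathbb{D}$ that fix $\zeta$ and have $\varphi'(\zeta) \neq 1$.
   Context: $\mathbb{D}$ is the open unit disk and $\mathbb{T}$ the unit circle in $\mathbb{C}$. $H^2(\mathbb{D})$ is the Hardy space of analytic functions $f(z)=\sum_{n\ge 0}a_nz^n$ on $\mathbb{D}$ with $\|f\|^2=\sum|a_n|^2<\infty$; $C_\varphi$ is the composition operator $f\mapsto f\circ\varphi$ on $H^2(\mathbb{D})$; $\mathcal{K}$ is the ideal of compact operators on $H^2(\mathbb{D})$. A linear-fractional self-map of $\mathbb{D}$ is a map $z\mapsto (az+b)/(cz+d)$ taking $\mathbb{D}$ into $\mathbb{D}$; it is a non-automorphism if it is not a bijection of $\mathbb{D}$ onto itself. $\mathcal{F}_\zeta$ is the set of all $C_\varphi$ with $\varphi$ a linear-fractional, non-automorphism self-map of $\mathbb{D}$ with $\varphi(\zeta)=\zeta$. Let $\Upsilon=\{z\in\mathbb{C}:\operatorname{Re} z>0\}$. $\mathbb{P}_\zeta=\{C_{\rho_{\zeta,a}}:a\in\Upsilon\}$, where $\rho_{\zeta,a}(z)=\frac{(2-a)z+a\zeta}{-a\overline{\zeta}z+(2+a)}$; these are the parabolic non-automorphism self-maps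 of $\mathbb{D}$ fixing $\zeta$ (a linear-fractional, non-automorphism self-map fixing $\zeta$ is parabolic if and only if its derivative at $\zeta$ is $1$). $C^*(\cdot)$ denotes the unital C$^*$-algebra of operators on $H^2(\mathbb{D})$ generated by the indicated operators. *)

theory Defs
  imports "HOL-Complex_Analysis.Complex_Analysis"
begin

section \<open>The Hardy space of the unit disk\<close>

abbreviation unit_disk :: "complex set" where
  "unit_disk \<equiv> ball 0 1"

text \<open>
  Since functions in HOL are total, an analytic function on the disk is represented by its
  extension by zero; this makes the representation unique.
\<close>

definition hardy_set :: "(complex \<Rightarrow> complex) set" where
  "hardy_set = {f. f holomorphic_on unit_disk \<and> (\<forall>z. z \<notin> unit_disk \<longrightarrow> f z = 0) \<and>
                   summable (\<lambda>n. (cmod (fps_nth (fps_expansion f 0) n))\<^sup>2)}"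

lemma taylor_add:
  assumes "f holomorphic_on unit_disk" "g holomorphic_on unit_disk"
  shows "fps_nth (fps_expansion (\<lambda>z. f z + g z) 0) n =
         fps_nth (fps_expansion f 0) n + fps_nth (fps_expansion g 0) n"
  using higher_deriv_add[OF assms, of 0 n] by (simp add: fps_expansion_def add_divide_distrib)

lemma taylor_cmult:
  assumes "f holomorphic_on unit_disk"
  shows "fps_nth (fps_expansion (\<lambda>z. c * f z) 0) n = c * fps_nth (fps_expansion f 0) n"
  using higher_deriv_cmult[OF assms, of 0 n c] by (simp add: fps_expansion_def)

lemma norm_add_square_le: "(cmod (a + b))\<^sup>2 \<le> 2 * (cmod a)\<^sup>2 + 2 * (cmod b)\<^sup>2"
proof -
  have "(cmod (a + b))\<^sup>2 \<le> (cmod a + cmod b)\<^sup>2"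
    by (intro power_mono norm_triangle_ineq) auto
  also have "\<dots> \<le> 2 * (cmod a)\<^sup>2 + 2 * (cmod b)\<^sup>2"
    using zero_le_power2[of "cmod a - cmod b"] by (simp add: power2_eq_square algebra_simps)
  finally show ?thesis .
qed

lemma hardy_set_zero: "(\<lambda>z. 0) \<in> hardy_set"
  using taylor_cmult[of "\<lambda>z. 0" 0] by (simp add: hardy_set_def)

lemma hardy_set_add:
  assumes "f \<in> hardy_set" "g \<in> hardy_set"
  shows "(\<lambda>z. f z + g z) \<in> hardy_set"
proof -
  let ?a = "\<lambda>n. fps_nth (fps_expansion f 0) n" and ?b = "\<lambda>n. fps_nth (fps_expansion g 0) n"
  have "summable (\<lambda>n. 2 * (cmod (?a n))\<^sup>2 + 2 * (cmod (?b n))\<^sup>2)"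
    using assms by (intro summable_add summable_mult) (auto simp: hardy_set_def)
  then have "summable (\<lambda>n. (cmod (?a n + ?b n))\<^sup>2)"
    by (rule summable_comparison_test') (simp add: norm_add_square_le)
  then show ?thesis
    using assms by (auto simp: hardy_set_def taylor_add intro!: holomorphic_intros)
qed

lemma hardy_set_cmult:
  assumes "f \<in> hardy_set"
  shows "(\<lambda>z. c * f z) \<in> hardy_set"
  using assms
  by (auto simp: hardy_set_def taylor_cmult norm_mult power_mult_distrib
           intro!: holomorphic_intros summable_mult)

typedef hardy = hardy_set
  morphisms hardy_fun Abs_hardy
  using hardy_set_zero by blast

setup_lifting type_definition_hardy

definition hardy_coeff :: "hardy \<Rightarrow> nat \<Rightarrow> complex" where
  "hardy_coeff f n = fps_nth (fps_expansion (hardy_fun f) 0) n"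

lift_definition hardy_scale :: "complex \<Rightarrow> hardy \<Rightarrow> hardy" is "\<lambda>c f z. c * f z"
  by (rule hardy_set_cmult)

definition hardy_inner :: "hardy \<Rightarrow> hardy \<Rightarrow> complex" where
  "hardy_inner f g = (\<Sum>n. hardy_coeff f n * cnj (hardy_coeff g n))"

instantiation hardy :: real_vector
begin

lift_definition zero_hardy :: hardy is "\<lambda>z. 0"
  by (rule hardy_set_zero)

lift_definition plus_hardy :: "hardy \<Rightarrow> hardy \<Rightarrow> hardy" is "\<lambda>f g z. f z + g z"
  by (rule hardy_set_add)

lift_definition uminus_hardy :: "hardy \<Rightarrow> hardy" is "\<lambda>f z. - f z"
  subgoal for f using hardy_set_cmult[of f "-1"] by simp
  done

lift_definition minus_hardy :: "hardy \<Rightarrow> hardy \<Rightarrow> hardy" is "\<lambda>f g z. f z - g z"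
  subgoal for f g using hardy_set_add[OF _ hardy_set_cmult[of g "-1"], of f] by simp
  done

lift_definition scaleR_hardy :: "real \<Rightarrow> hardy \<Rightarrow> hardy" is "\<lambda>r f z. of_real r * f z"
  by (rule hardy_set_cmult)

instance
  by standard (transfer; simp add: fun_eq_iff algebra_simps)+

end

lemma hardy_holomorphic: "hardy_fun f holomorphic_on unit_disk"
  using hardy_fun[of f] by (simp add: hardy_set_def)

lemma hardy_coeff_add: "hardy_coeff (f + g) n = hardy_coeff f n + hardy_coeff g n"
  by (simp add: hardy_coeff_def plus_hardy.rep_eq taylor_add hardy_holomorphic)

lemma hardy_coeff_scale: "hardy_coeff (hardy_scale c f) n = c * hardy_coeff f n"
  by (simp add: hardy_coeff_def hardy_scale.rep_eq taylor_cmult hardy_holomorphic)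

lemma scaleR_hardy_eq: "r *\<^sub>R f = hardy_scale (of_real r) f"
  by transfer simp

lemma summable_hardy_coeff: "summable (\<lambda>n. (cmod (hardy_coeff f n))\<^sup>2)"
  using hardy_fun[of f] by (simp add: hardy_set_def hardy_coeff_def)

lemma summable_hardy_inner: "summable (\<lambda>n. hardy_coeff f n * cnj (hardy_coeff g n))"
proof (rule summable_comparison_test')
  show "summable (\<lambda>n. (cmod (hardy_coeff f n))\<^sup>2 + (cmod (hardy_coeff g n))\<^sup>2)"
    by (intro summable_add summable_hardy_coeff)
  fix n
  have "cmod (hardy_coeff f n) * cmod (hardy_coeff g n) \<le>
        (cmod (hardy_coeff f n))\<^sup>2 + (cmod (hardy_coeff g n))\<^sup>2"
    using sum_squares_bound[of "cmod (hardy_coeff f n)" "cmod (hardy_coeff g n)"]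
          mult_nonneg_nonneg[OF norm_ge_zero norm_ge_zero, of "hardy_coeff f n" "hardy_coeff g n"]
    by linarith
  then show "norm (hardy_coeff f n * cnj (hardy_coeff g n)) \<le>
        (cmod (hardy_coeff f n))\<^sup>2 + (cmod (hardy_coeff g n))\<^sup>2"
    by (simp add: norm_mult)
qed

lemma hardy_inner_add_left: "hardy_inner (f + g) h = hardy_inner f h + hardy_inner g h"
  by (simp add: hardy_inner_def hardy_coeff_add ring_distribs summable_hardy_inner
           flip: suminf_add)

lemma hardy_inner_scale_left: "hardy_inner (hardy_scale c f) g = c * hardy_inner f g"
  by (simp add: hardy_inner_def hardy_coeff_scale mult.assoc suminf_mult summable_hardy_inner)

lemma hardy_inner_commute: "hardy_inner g f = cnj (hardy_inner f g)"
proof -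
  have "(\<lambda>n. cnj (hardy_coeff f n * cnj (hardy_coeff g n))) sums cnj (hardy_inner f g)"
    unfolding hardy_inner_def sums_cnj using summable_hardy_inner by (rule summable_sums)
  then show ?thesis
    by (simp add: hardy_inner_def sums_iff mult.commute)
qed

lemma hardy_inner_self: "hardy_inner f f = of_real (\<Sum>n. (cmod (hardy_coeff f n))\<^sup>2)"
  by (simp add: hardy_inner_def complex_norm_square[symmetric] suminf_of_real
           summable_hardy_coeff flip: of_real_power)

lemma hardy_eqI:
  assumes "\<And>n. hardy_coeff f n = hardy_coeff g n"
  shows "f = g"
proof -
  have "hardy_fun f z = hardy_fun g z" for z
  proof (cases "z \<in> unit_disk")
    case True
    show ?thesis
      by (rule holomorphic_fun_eq_on_ball[OF hardy_holomorphic hardy_holomorphic True])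
         (use assms in \<open>simp add: hardy_coeff_def fps_expansion_def\<close>)
  next
    case False
    then show ?thesis
      using hardy_fun[of f] hardy_fun[of g] by (simp add: hardy_set_def)
  qed
  then show ?thesis
    by (simp add: hardy_fun_inject[symmetric] fun_eq_iff)
qed

lemma hardy_coeff_zero: "hardy_coeff 0 n = 0"
proof -
  have "hardy_scale 0 0 = 0" by transfer simp
  then show ?thesis using hardy_coeff_scale[of 0 0 n] by simp
qed

instantiation hardy :: real_inner
begin

definition norm_hardy :: "hardy \<Rightarrow> real" where
  "norm_hardy f = sqrt (\<Sum>n. (cmod (hardy_coeff f n))\<^sup>2)"

definition inner_hardy :: "hardy \<Rightarrow> hardy \<Rightarrow> real" where
  "inner_hardy f g = Re (hardy_inner f g)"

definition dist_hardy :: "hardy \<Rightarrow> hardy \<Rightarrow> real" where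
  "dist_hardy f g = norm (f - g)"

definition sgn_hardy :: "hardy \<Rightarrow> hardy" where
  "sgn_hardy f = f /\<^sub>R norm f"

definition uniformity_hardy :: "(hardy \<times> hardy) filter" where
  "uniformity_hardy = (INF e\<in>{0 <..}. principal {(x, y). dist x y < e})"

definition open_hardy :: "hardy set \<Rightarrow> bool" where
  "open_hardy U = (\<forall>x\<in>U. eventually (\<lambda>(x', y). x' = x \<longrightarrow> y \<in> U) uniformity)"

instance
proof
  fix f g h :: hardy and r :: real
  show "sgn f = f /\<^sub>R norm f" "dist f g = norm (f - g)"
    by (simp_all add: sgn_hardy_def dist_hardy_def)
  show "(uniformity :: (hardy \<times> hardy) filter) =
        (INF e\<in>{0 <..}. principal {(x, y). dist x y < e})"
    by (simp add: uniformity_hardy_def)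
  show "open U = (\<forall>x\<in>U. eventually (\<lambda>(x', y). x' = x \<longrightarrow> y \<in> U) uniformity)" for U :: "hardy set"
    by (simp add: open_hardy_def)
  show "inner f g = inner g f"
    using hardy_inner_commute[of f g] by (simp add: inner_hardy_def)
  show "inner (f + g) h = inner f h + inner g h"
    by (simp add: inner_hardy_def hardy_inner_add_left)
  show "inner (r *\<^sub>R f) g = r * inner f g"
    by (simp add: inner_hardy_def scaleR_hardy_eq hardy_inner_scale_left)
  show "0 \<le> inner f f"
    by (simp add: inner_hardy_def hardy_inner_self suminf_nonneg summable_hardy_coeff)
  show "inner f f = 0 \<longleftrightarrow> f = 0"
  proof
    assume "inner f f = 0"
    then have "hardy_coeff f n = 0" for n
      using suminf_eq_zero_iff[OF summable_hardy_coeff[of f]]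
      by (simp add: inner_hardy_def hardy_inner_self)
    then show "f = 0"
      by (intro hardy_eqI) (simp add: hardy_coeff_zero)
  qed (simp add: inner_hardy_def hardy_inner_def hardy_coeff_zero)
  show "norm f = sqrt (inner f f)"
    by (simp add: norm_hardy_def inner_hardy_def hardy_inner_self)
qed

end

lemma norm_hardy_scale: "norm (hardy_scale c f) = cmod c * norm f"
  by (simp add: norm_hardy_def hardy_coeff_scale norm_mult power_mult_distrib suminf_mult
           summable_hardy_coeff real_sqrt_mult)

section \<open>Operators on the Hardy space\<close>

text \<open>
  The type \<^typ>\<open>hardy \<Rightarrow>\<^sub>L hardy\<close> consists of the real-linear bounded operators;
  the operators of interest are the complex-linear ones among them.
\<close>

definition hardy_ops :: "(hardy \<Rightarrow>\<^sub>L hardy) set" where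
  "hardy_ops = {T. \<forall>c f. blinfun_apply T (hardy_scale c f) = hardy_scale c (blinfun_apply T f)}"

definition op_scale :: "complex \<Rightarrow> (hardy \<Rightarrow>\<^sub>L hardy) \<Rightarrow> (hardy \<Rightarrow>\<^sub>L hardy)" where
  "op_scale c T = Blinfun (\<lambda>f. hardy_scale c (blinfun_apply T f))"

lemma bounded_linear_hardy_scale: "bounded_linear (hardy_scale c)"
proof (rule bounded_linear_intro)
  show "hardy_scale c (f + g) = hardy_scale c f + hardy_scale c g" for f g
    by transfer (simp add: algebra_simps)
  show "hardy_scale c (r *\<^sub>R f) = r *\<^sub>R hardy_scale c f" for r f
    by transfer (simp add: algebra_simps)
  show "norm (hardy_scale c f) \<le> norm f * cmod c" for f
    by (simp add: norm_hardy_scale mult.commute)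
qed

lemma op_scale_apply: "blinfun_apply (op_scale c T) f = hardy_scale c (blinfun_apply T f)"
  unfolding op_scale_def
  by (subst bounded_linear_Blinfun_apply)
     (auto intro: bounded_linear_compose bounded_linear_hardy_scale blinfun.bounded_linear_right)

definition is_adjoint :: "(hardy \<Rightarrow>\<^sub>L hardy) \<Rightarrow> (hardy \<Rightarrow>\<^sub>L hardy) \<Rightarrow> bool" where
  "is_adjoint T S \<longleftrightarrow>
     (\<forall>f g. hardy_inner (blinfun_apply T f) g = hardy_inner f (blinfun_apply S g))"

definition unital_cstar_algebra :: "(hardy \<Rightarrow>\<^sub>L hardy) set \<Rightarrow> bool" where
  "unital_cstar_algebra A \<longleftrightarrow>
     A \<subseteq> hardy_ops \<and> closed A \<and> id_blinfun \<in> A \<and>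
     (\<forall>S\<in>A. \<forall>T\<in>A. S + T \<in> A) \<and>
     (\<forall>c. \<forall>T\<in>A. op_scale c T \<in> A) \<and>
     (\<forall>S\<in>A. \<forall>T\<in>A. S o\<^sub>L T \<in> A) \<and>
     (\<forall>T\<in>A. \<exists>S\<in>A. is_adjoint T S)"

definition cstar_gen :: "(hardy \<Rightarrow>\<^sub>L hardy) set \<Rightarrow> (hardy \<Rightarrow>\<^sub>L hardy) set" where
  "cstar_gen G = \<Inter>{A. unital_cstar_algebra A \<and> G \<subseteq> A}"

definition compact_ops :: "(hardy \<Rightarrow>\<^sub>L hardy) set" where
  "compact_ops = {T \<in> hardy_ops. compact (closure (blinfun_apply T ` cball 0 1))}"

section \<open>Composition operators with linear-fractional symbol\<close>

text \<open>
  The operator is unique when it exists, and for every analytic self-map of the disk it exists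
  by Littlewood's subordination theorem.
\<close>

definition is_composition_op :: "(complex \<Rightarrow> complex) \<Rightarrow> (hardy \<Rightarrow>\<^sub>L hardy) \<Rightarrow> bool" where
  "is_composition_op \<phi> T \<longleftrightarrow>
     (\<forall>f. \<forall>z\<in>unit_disk. hardy_fun (blinfun_apply T f) z = hardy_fun f (\<phi> z))"

text \<open>
  The map is kept as a function on the whole plane, so that its value and its derivative at a
  boundary point make sense. It has the junk value 0 at its pole, which is explicitly kept
  off the disk; the self-map property then also keeps it off the unit circle.
\<close>

definition lin_frac_self_map :: "(complex \<Rightarrow> complex) \<Rightarrow> bool" where
  "lin_frac_self_map \<phi> \<longleftrightarrow>
     (\<exists>a b c d. a * d - b * c \<noteq> 0 \<and> \<phi> = moebius a b c d \<and>
                (\<forall>z\<in>unit_disk. c * z + d \<noteq> 0)) \<and>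
     \<phi> ` unit_disk \<subseteq> unit_disk"

definition lin_frac_nonauto :: "(complex \<Rightarrow> complex) \<Rightarrow> bool" where
  "lin_frac_nonauto \<phi> \<longleftrightarrow> lin_frac_self_map \<phi> \<and> \<not> bij_betw \<phi> unit_disk unit_disk"

definition F_ops :: "complex \<Rightarrow> (hardy \<Rightarrow>\<^sub>L hardy) set" where
  "F_ops \<zeta> = {T. \<exists>\<phi>. lin_frac_nonauto \<phi> \<and> \<phi> \<zeta> = \<zeta> \<and> is_composition_op \<phi> T}"

definition parabolic_map :: "complex \<Rightarrow> complex \<Rightarrow> complex \<Rightarrow> complex" where
  "parabolic_map \<zeta> a z = ((2 - a) * z + a * \<zeta>) / (- a * cnj \<zeta> * z + (2 + a))"

definition P_ops :: "complex \<Rightarrow> (hardy \<Rightarrow>\<^sub>L hardy) set" where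
  "P_ops \<zeta> = {T. \<exists>a. 0 < Re a \<and> is_composition_op (parabolic_map \<zeta> a) T}"

end

theory Submission
  imports Defs
begin

text \<open>
  In the coordinate \<open>w = (\<zeta> + z) / (\<zeta> - z)\<close>, which carries the disk to the right half-plane and
  \<open>\<zeta>\<close> to infinity, the linear-fractional self-maps fixing \<open>\<zeta>\<close> are exactly the affine maps
  \<open>w \<mapsto> t w + b\<close> with \<open>t > 0\<close> and \<open>Re b \<ge> 0\<close>. Such a map has derivative \<open>1 / t\<close> at \<open>\<zeta>\<close>. The
  non-automorphisms are the maps with \<open>Re b > 0\<close>, and the parabolic ones among them have \<open>t = 1\<close>.

  \<^bold>\<open>Parabolic operators come from the others.\<close> A translation \<open>w \<mapsto> w + a\<close> with \<open>Re a > 0\<close> is a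
  contraction \<open>w \<mapsto> t w + (1 - t)\<close> followed by an expansion \<open>w \<mapsto> w / t + c\<close>, where \<open>t < 1\<close> is chosen so
  close to 1 that \<open>Re c > 0\<close>. Neither factor is parabolic, so every parabolic composition operator is
  a product of two non-parabolic ones (\<open>P_ops_factor\<close>), once the two factors are known to induce
  bounded operators.

  \<^bold>\<open>Boundedness.\<close> Every map \<open>w \<mapsto> t w + b\<close> is a contraction \<open>w \<mapsto> t w + (1 - t)\<close>, which fixes the
  origin of the disk, followed by an automorphism \<open>w \<mapsto> s w + \<i> y\<close>. The contraction is the map
  \<open>t z / (1 - (1 - t) cnj \<zeta> z)\<close>; the absolute values of the Taylor coefficients of its powers are
  negative binomial probabilities, and a Schur test bounds its composition operator
  (\<open>contraction_op\<close>). For the automorphism \<open>\<alpha> = (cnj d z + cnj c) / (c z + d)\<close> the functions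
  \<open>\<alpha>\<^sup>n / (c z + d)\<close> are orthogonal and of equal norm, which gives a bound after multiplication by
  \<open>c z + d\<close> (\<open>automorphism_op\<close>).

  \<^bold>\<open>Compact operators come from composition operators.\<close> The Schur test gives more: on functions
  vanishing at the origin, composition with the contraction has norm at most \<open>sqrt t\<close>. As \<open>t\<close> tends
  to 0 these operators therefore converge in norm to \<open>f \<mapsto> f 0\<close>, a rank-one operator
  (\<open>evaluation_at_0_in_cstar\<close>). Adjoints of composition operators send the constant 1 to reproducing
  kernels, so the algebra contains the rank-one operators \<open>f \<mapsto> f 0 k\<close> for the kernels \<open>k\<close> at the
  points of the radius towards \<open>\<zeta>\<close>. Difference quotients of these kernels at the origin yield all monomials
  (\<open>monom_rank_one_in_cstar\<close>). Taking adjoints and products gives all matrix units, and these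
  generate the compact operators (\<open>compact_in_cstar\<close>).
\<close>

section \<open>The Hardy space in terms of Taylor coefficients\<close>

lemma hardy_fun_eqI:
  assumes "\<And>z. z \<in> unit_disk \<Longrightarrow> hardy_fun f z = hardy_fun g z"
  shows "f = g"
proof -
  have "hardy_fun f z = hardy_fun g z" for z
    using assms[of z] hardy_fun[of f] hardy_fun[of g] by (cases "z \<in> unit_disk") (auto simp: hardy_set_def)
  then show ?thesis
    by (simp add: hardy_fun_inject[symmetric] fun_eq_iff)
qed

lemma hardy_sums:
  assumes "z \<in> unit_disk"
  shows "(\<lambda>n. hardy_coeff f n * z ^ n) sums hardy_fun f z"
  using holomorphic_power_series[OF hardy_holomorphic assms, of f]
  by (simp add: hardy_coeff_def fps_expansion_def)

lemma hardy_of_function: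
  assumes "f holomorphic_on unit_disk"
    and "summable (\<lambda>n. (cmod (fps_nth (fps_expansion f 0) n))\<^sup>2)"
  obtains h where "\<And>z. z \<in> unit_disk \<Longrightarrow> hardy_fun h z = f z"
    and "\<And>n. hardy_coeff h n = fps_nth (fps_expansion f 0) n"
proof -
  let ?f = "\<lambda>z. if z \<in> unit_disk then f z else 0"
  have ev: "eventually (\<lambda>z. ?f z = f z) (nhds 0)"
    using eventually_nhds_in_open[of unit_disk 0] by (auto elim: eventually_mono)
  then have eq: "fps_expansion ?f 0 = fps_expansion f 0"
    by (rule fps_expansion_cong)
  have "?f holomorphic_on unit_disk"
    using assms(1) by (rule holomorphic_transform) simp
  then have "?f \<in> hardy_set"
    using assms(2) eq by (simp add: hardy_set_def)
  then have "hardy_fun (Abs_hardy ?f) = ?f"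
    by (rule Abs_hardy_inverse)
  then show ?thesis
    by (intro that[of "Abs_hardy ?f"]) (simp_all only: hardy_coeff_def eq if_True)
qed

lemma hardy_of_coeffs:
  assumes "summable (\<lambda>n. (cmod (a n))\<^sup>2)"
  obtains h where "\<And>n. hardy_coeff h n = a n"
proof -
  have "(\<lambda>n. (cmod (a n))\<^sup>2) \<longlonglongrightarrow> 0"
    using assms by (rule summable_LIMSEQ_zero)
  then have "Bseq (\<lambda>n. (cmod (a n))\<^sup>2)"
    by (intro convergent_imp_Bseq convergentI)
  then obtain B where B: "B > 0" "\<And>n. (cmod (a n))\<^sup>2 \<le> B"
    by (auto simp: Bseq_def)
  have bd: "cmod (a n) \<le> sqrt B" for n
    using B(2)[of n] by (simp add: real_le_rsqrt)
  define f where "f z = (\<Sum>n. a n * z ^ n)" for z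
  have s: "(\<lambda>n. a n * z ^ n) sums f z" if "z \<in> unit_disk" for z
    unfolding f_def
  proof (rule summable_sums, rule summable_comparison_test')
    show "summable (\<lambda>n. sqrt B * cmod z ^ n)"
      using that by (intro summable_mult summable_geometric) simp
    show "norm (a n * z ^ n) \<le> sqrt B * cmod z ^ n" for n
      using bd[of n] by (simp add: norm_mult norm_power mult_right_mono)
  qed
  have hol: "f holomorphic_on unit_disk"
    by (rule power_series_holomorphic[where a = a]) (use s in simp)
  have coeff: "fps_nth (fps_expansion f 0) n = a n" for n
  proof -
    have "f has_fps_expansion Abs_fps a"
      by (rule has_fps_expansionI)
        (use s in \<open>auto intro!: eventually_mono[OF eventually_nhds_in_open[of unit_disk 0]]\<close>)
    then have "fps_expansion f 0 = Abs_fps a"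
      by (rule fps_expansion_eqI)
    then show ?thesis by simp
  qed
  show ?thesis
    by (rule hardy_of_function[OF hol]) (use assms coeff that in auto)
qed

definition hardy_of_seq :: "(nat \<Rightarrow> complex) \<Rightarrow> hardy" where
  "hardy_of_seq a = (THE h. \<forall>n. hardy_coeff h n = a n)"

lemma hardy_coeff_of_seq:
  assumes "summable (\<lambda>n. (cmod (a n))\<^sup>2)"
  shows "hardy_coeff (hardy_of_seq a) n = a n"
proof -
  obtain h where h: "\<And>n. hardy_coeff h n = a n"
    using hardy_of_coeffs[OF assms] by blast
  have "\<exists>!h. \<forall>n. hardy_coeff h n = a n"
  proof
    show "\<forall>n. hardy_coeff h n = a n" using h by simp
  qed (use h in \<open>auto intro: hardy_eqI\<close>)
  then have "\<forall>n. hardy_coeff (hardy_of_seq a) n = a n"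
    unfolding hardy_of_seq_def by (rule theI')
  then show ?thesis ..
qed

lemma norm_hardy_sq: "(norm f)\<^sup>2 = (\<Sum>n. (cmod (hardy_coeff f n))\<^sup>2)"
  by (simp add: norm_hardy_def suminf_nonneg summable_hardy_coeff)

lemma sum_coeff_le_norm: "(\<Sum>k<K. (cmod (hardy_coeff f k))\<^sup>2) \<le> (norm f)\<^sup>2"
  unfolding norm_hardy_sq by (rule sum_le_suminf[OF summable_hardy_coeff]) auto

lemma coeff_le_norm: "cmod (hardy_coeff f n) \<le> norm f"
proof -
  have "(cmod (hardy_coeff f n))\<^sup>2 \<le> (\<Sum>k<Suc n. (cmod (hardy_coeff f k))\<^sup>2)"
    by (simp add: sum_nonneg)
  also have "\<dots> \<le> (norm f)\<^sup>2" by (rule sum_coeff_le_norm)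
  finally show ?thesis by (rule power2_le_imp_le) simp
qed

lemma norm_hardy_leI:
  assumes "\<And>K. (\<Sum>k<K. (cmod (hardy_coeff f k))\<^sup>2) \<le> B\<^sup>2" "B \<ge> 0"
  shows "norm f \<le> B"
proof -
  have "(norm f)\<^sup>2 \<le> B\<^sup>2"
    unfolding norm_hardy_sq by (rule suminf_le_const[OF summable_hardy_coeff assms(1)])
  then show ?thesis using assms(2) by (rule power2_le_imp_le)
qed

lemma hardy_fun_add: "hardy_fun (f + g) z = hardy_fun f z + hardy_fun g z"
  by (simp add: plus_hardy.rep_eq)

lemma hardy_fun_scale: "hardy_fun (hardy_scale c f) z = c * hardy_fun f z"
  by (simp add: hardy_scale.rep_eq)

lemma hardy_fun_zero: "hardy_fun 0 z = 0"
  by (simp add: zero_hardy.rep_eq)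

lemma hardy_fun_sum: "hardy_fun (\<Sum>i\<in>I. f i) z = (\<Sum>i\<in>I. hardy_fun (f i) z)"
  by (induction I rule: infinite_finite_induct) (auto simp: hardy_fun_add hardy_fun_zero)

lemma hardy_coeff_sum: "hardy_coeff (\<Sum>i\<in>I. f i) n = (\<Sum>i\<in>I. hardy_coeff (f i) n)"
  by (induction I rule: infinite_finite_induct) (auto simp: hardy_coeff_add hardy_coeff_zero)

lemma hardy_coeff_diff: "hardy_coeff (f - g) n = hardy_coeff f n - hardy_coeff g n"
  using hardy_coeff_add[of "f - g" g n] by simp

lemma hardy_fun_0: "hardy_fun f 0 = hardy_coeff f 0"
  by (simp add: hardy_coeff_def fps_expansion_def)

lemma linear_scale: "linear (hardy_scale c)"
  using bounded_linear_hardy_scale bounded_linear.linear by blast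

lemmas hardy_scale_add = linear_add[OF linear_scale]
lemmas hardy_scale_diff = linear_diff[OF linear_scale]

lemma hardy_scale_add_left: "hardy_scale (a + b) f = hardy_scale a f + hardy_scale b f"
  by transfer (simp add: algebra_simps)

lemma hardy_scale_diff_left: "hardy_scale (a - b) f = hardy_scale a f - hardy_scale b f"
  using hardy_scale_add_left[of "a - b" b f] by simp

lemma hardy_scale_scale: "hardy_scale a (hardy_scale b f) = hardy_scale (a * b) f"
  by transfer (simp add: mult.assoc)

lemma hardy_scale_one [simp]: "hardy_scale 1 f = f"
  by transfer simp

lemma hardy_scale_0 [simp]: "hardy_scale 0 f = 0"
  by transfer simp

definition hardy_monom :: "nat \<Rightarrow> hardy" where
  "hardy_monom n = hardy_of_seq (\<lambda>k. if k = n then 1 else 0)"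

lemma coeff_monom: "hardy_coeff (hardy_monom n) k = (if k = n then 1 else 0)"
  unfolding hardy_monom_def
  by (subst hardy_coeff_of_seq) (auto intro!: summable_finite[of "{n}"] split: if_splits)

lemma fun_monom:
  assumes "z \<in> unit_disk"
  shows "hardy_fun (hardy_monom n) z = z ^ n"
proof -
  have "(\<lambda>k. if k = n then z ^ n else 0) sums hardy_fun (hardy_monom n) z"
    using hardy_sums[OF assms, of "hardy_monom n"]
    by (rule sums_cong[THEN iffD1, rotated]) (simp add: coeff_monom)
  moreover have "(\<lambda>k. if k = n then z ^ n else 0) sums (z ^ n)"
    by (rule sums_single)
  ultimately show ?thesis by (rule sums_unique2)
qed

lemma norm_monom_le: "norm (hardy_monom n) \<le> 1"
proof (rule norm_hardy_leI)
  show "(\<Sum>k<K. (cmod (hardy_coeff (hardy_monom n) k))\<^sup>2) \<le> 1\<^sup>2" for K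
    by (simp add: coeff_monom if_distrib[of cmod] if_distrib[of "\<lambda>x. x\<^sup>2"] cong: if_cong)
qed simp

lemma inner_monom_right: "hardy_inner f (hardy_monom n) = hardy_coeff f n"
proof -
  have "hardy_inner f (hardy_monom n) = (\<Sum>k. if k = n then hardy_coeff f n else 0)"
    unfolding hardy_inner_def by (intro suminf_cong) (simp add: coeff_monom)
  also have "\<dots> = hardy_coeff f n"
    by (rule sums_unique[symmetric, OF sums_single])
  finally show ?thesis .
qed

lemma inner_monom_left: "hardy_inner (hardy_monom n) f = cnj (hardy_coeff f n)"
  by (subst hardy_inner_commute) (simp add: inner_monom_right)

definition trunc :: "nat \<Rightarrow> hardy \<Rightarrow> hardy" where
  "trunc N f = (\<Sum>n<N. hardy_scale (hardy_coeff f n) (hardy_monom n))"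

lemma coeff_trunc: "hardy_coeff (trunc N f) k = (if k < N then hardy_coeff f k else 0)"
proof -
  have "hardy_coeff (trunc N f) k = (\<Sum>n<N. if n = k then hardy_coeff f k else 0)"
    unfolding trunc_def hardy_coeff_sum
    by (intro sum.cong) (auto simp: hardy_coeff_scale coeff_monom)
  then show ?thesis by simp
qed

lemma trunc_norm_le: "norm (trunc N f) \<le> norm f"
proof (rule norm_hardy_leI)
  fix K
  have "(\<Sum>k<K. (cmod (hardy_coeff (trunc N f) k))\<^sup>2) \<le> (\<Sum>k<K. (cmod (hardy_coeff f k))\<^sup>2)"
    by (intro sum_mono) (simp add: coeff_trunc)
  also have "\<dots> \<le> (norm f)\<^sup>2" by (rule sum_coeff_le_norm)
  finally show "(\<Sum>k<K. (cmod (hardy_coeff (trunc N f) k))\<^sup>2) \<le> (norm f)\<^sup>2" .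
qed simp

lemma trunc_tendsto: "(\<lambda>N. trunc N f) \<longlonglongrightarrow> f"
proof -
  let ?a = "\<lambda>n. (cmod (hardy_coeff f n))\<^sup>2"
  have eq: "(norm (trunc N f - f))\<^sup>2 = (\<Sum>n. ?a n) - (\<Sum>n<N. ?a n)" for N
  proof -
    have "(norm (trunc N f - f))\<^sup>2 = (\<Sum>n. ?a n - (if n < N then ?a n else 0))"
      unfolding norm_hardy_sq
      by (intro suminf_cong) (simp add: hardy_coeff_diff coeff_trunc)
    also have "\<dots> = (\<Sum>n. ?a n) - (\<Sum>n. if n < N then ?a n else 0)"
      by (intro suminf_diff[symmetric] summable_hardy_coeff)
         (auto intro!: summable_finite[of "{..<N}"])
    also have "(\<Sum>n. if n < N then ?a n else 0) = (\<Sum>n<N. ?a n)"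
      by (subst suminf_finite[of "{..<N}"]) auto
    finally show ?thesis .
  qed
  have "(\<lambda>N. (\<Sum>n. ?a n) - (\<Sum>n<N. ?a n)) \<longlonglongrightarrow> (\<Sum>n. ?a n) - (\<Sum>n. ?a n)"
    by (intro tendsto_diff tendsto_const summable_LIMSEQ summable_hardy_coeff)
  then have "(\<lambda>N. sqrt ((norm (trunc N f - f))\<^sup>2)) \<longlonglongrightarrow> sqrt 0"
    unfolding eq by (intro tendsto_real_sqrt) simp
  then have "(\<lambda>N. norm (trunc N f - f)) \<longlonglongrightarrow> 0"
    by simp
  then show ?thesis
    by (rule LIM_zero_cancel[OF tendsto_norm_zero_cancel])
qed

definition shift :: "hardy \<Rightarrow> hardy" where
  "shift f = hardy_of_seq (\<lambda>n. case n of 0 \<Rightarrow> 0 | Suc k \<Rightarrow> hardy_coeff f k)"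

lemma coeff_shift: "hardy_coeff (shift f) n = (case n of 0 \<Rightarrow> 0 | Suc k \<Rightarrow> hardy_coeff f k)"
  unfolding shift_def
  by (rule hardy_coeff_of_seq, subst summable_Suc_iff[symmetric]) (simp add: summable_hardy_coeff)

lemma fun_shift:
  assumes "z \<in> unit_disk"
  shows "hardy_fun (shift f) z = z * hardy_fun f z"
proof -
  have "(\<lambda>n. hardy_coeff (shift f) (Suc n) * z ^ Suc n) sums (z * hardy_fun f z)"
    using sums_mult[OF hardy_sums[OF assms, of f], of z]
    by (simp add: coeff_shift mult_ac)
  then have "(\<lambda>n. hardy_coeff (shift f) n * z ^ n) sums (z * hardy_fun f z)"
    by (subst (asm) sums_Suc_iff) (simp add: coeff_shift)
  with hardy_sums[OF assms] show ?thesis by (rule sums_unique2)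
qed

lemma norm_shift: "norm (shift f) = norm f"
proof -
  have "(\<Sum>n. (cmod (hardy_coeff (shift f) n))\<^sup>2) = (\<Sum>n. (cmod (hardy_coeff f n))\<^sup>2)"
    using suminf_split_head[OF summable_hardy_coeff[of "shift f"]] by (simp add: coeff_shift)
  then show ?thesis by (simp add: norm_hardy_def)
qed

section \<open>Composition operators from bounds on polynomials\<close>

lemma composition_op_unique:
  assumes "is_composition_op \<phi> S" "is_composition_op \<psi> T"
    and "\<And>z. z \<in> unit_disk \<Longrightarrow> \<phi> z = \<psi> z"
  shows "S = T"
  using assms by (intro blinfun_eqI hardy_fun_eqI) (simp add: is_composition_op_def)

lemma composition_op_cong:
  assumes "is_composition_op \<phi> T" "\<And>z. z \<in> unit_disk \<Longrightarrow> \<phi> z = \<psi> z"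
  shows "is_composition_op \<psi> T"
  using assms by (simp add: is_composition_op_def)

lemma composition_op_compose:
  assumes "is_composition_op \<phi> S" "is_composition_op \<psi> T" "\<phi> ` unit_disk \<subseteq> unit_disk"
  shows "is_composition_op (\<psi> \<circ> \<phi>) (S o\<^sub>L T)"
  using assms by (auto simp: is_composition_op_def image_subset_iff)

lemma composition_op_monom:
  assumes "is_composition_op \<phi> T" "z \<in> unit_disk" "\<phi> z \<in> unit_disk"
  shows "hardy_fun (blinfun_apply T (hardy_monom n)) z = \<phi> z ^ n"
  using assms fun_monom by (simp add: is_composition_op_def)

text \<open>
  A uniform bound on polynomials suffices: the compositions \<open>f\<^sub>N \<circ> \<phi>\<close> of the Taylor polynomials of \<open>f\<close>
  converge to \<open>f \<circ> \<phi>\<close> uniformly near the origin, hence coefficientwise, and the bound on the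
  partial sums of squares passes to the limit.
\<close>

lemma composition_function_in_hardy:
  assumes hol: "\<phi> holomorphic_on unit_disk" and self: "\<phi> ` unit_disk \<subseteq> unit_disk"
    and "M \<ge> 0"
    and bd: "\<And>c N. \<exists>G. (\<forall>z\<in>unit_disk. hardy_fun G z = (\<Sum>n<N. c n * \<phi> z ^ n)) \<and>
                norm G \<le> M * sqrt (\<Sum>n<N. (cmod (c n))\<^sup>2)"
  shows "\<exists>g. (\<forall>z\<in>unit_disk. hardy_fun g z = hardy_fun f (\<phi> z)) \<and> norm g \<le> M * norm f"
proof -
  let ?h = "\<lambda>z. hardy_fun f (\<phi> z)"
  have "\<exists>G. \<forall>N. (\<forall>z\<in>unit_disk. hardy_fun (G N) z = (\<Sum>n<N. hardy_coeff f n * \<phi> z ^ n)) \<and>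
                norm (G N) \<le> M * sqrt (\<Sum>n<N. (cmod (hardy_coeff f n))\<^sup>2)"
    by (intro choice allI bd)
  then obtain G where G: "\<And>N z. z \<in> unit_disk \<Longrightarrow> hardy_fun (G N) z = (\<Sum>n<N. hardy_coeff f n * \<phi> z ^ n)"
    and "\<And>N. norm (G N) \<le> M * sqrt (\<Sum>n<N. (cmod (hardy_coeff f n))\<^sup>2)"
    by blast
  moreover have "sqrt (\<Sum>n<N. (cmod (hardy_coeff f n))\<^sup>2) \<le> norm f" for N
    by (rule real_le_lsqrt) (simp_all add: sum_coeff_le_norm)
  ultimately have nG: "norm (G N) \<le> M * norm f" for N
    using \<open>M \<ge> 0\<close> by (meson mult_left_mono order_trans)
  have holh: "?h holomorphic_on unit_disk"
    using holomorphic_on_compose_gen[OF hol hardy_holomorphic self, of f] by (simp add: o_def)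
  \<comment> \<open>The image of the closed disk of radius 1/2 stays away from the unit circle.\<close>
  have ul: "uniform_limit (ball 0 (1/2)) (\<lambda>N z. hardy_fun (G N) z) ?h sequentially"
  proof -
    have "compact (\<phi> ` cball 0 (1/2))"
      by (intro compact_continuous_image holomorphic_on_imp_continuous_on
            holomorphic_on_subset[OF hol]) auto
    then obtain w where w: "w \<in> \<phi> ` cball 0 (1/2)" "\<forall>x\<in>\<phi> ` cball 0 (1/2). cmod x \<le> cmod w"
      using continuous_attains_sup[of "\<phi> ` cball 0 (1/2)" cmod] by (auto intro!: continuous_intros)
    define r where "r = cmod w"
    have "w \<in> unit_disk" using w(1) self by fastforce
    then have r: "r < 1" "0 \<le> r" by (auto simp: r_def)
    have "uniform_limit (ball 0 (1/2)) (\<lambda>N z. \<Sum>n<N. hardy_coeff f n * \<phi> z ^ n)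
            (\<lambda>z. \<Sum>n. hardy_coeff f n * \<phi> z ^ n) sequentially"
    proof (rule Weierstrass_m_test)
      show "summable (\<lambda>n. norm f * r ^ n)"
        using r by (intro summable_mult summable_geometric) simp
      fix n and z :: complex assume "z \<in> ball 0 (1/2)"
      then have "cmod (\<phi> z) \<le> r" using w(2) by (auto simp: r_def)
      then show "norm (hardy_coeff f n * \<phi> z ^ n) \<le> norm f * r ^ n"
        by (auto simp: norm_mult norm_power intro!: mult_mono power_mono coeff_le_norm)
    qed
    then show ?thesis
    proof (rule uniform_limit_cong'[THEN iffD1, rotated 2])
      fix z :: complex assume "z \<in> ball 0 (1/2)"
      then have z: "z \<in> unit_disk" by auto
      then show "(\<Sum>n<N. hardy_coeff f n * \<phi> z ^ n) = hardy_fun (G N) z" for N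
        using G by simp
      have "\<phi> z \<in> unit_disk" using z self by blast
      from sums_unique[OF hardy_sums[OF this, of f]]
      show "(\<Sum>n. hardy_coeff f n * \<phi> z ^ n) = hardy_fun f (\<phi> z)" by simp
    qed
  qed
  define b where "b k = fps_nth (fps_expansion ?h 0) k" for k
  have lim: "(\<lambda>N. hardy_coeff (G N) k) \<longlonglongrightarrow> b k" for k
  proof -
    have "(\<lambda>N. (deriv ^^ k) (hardy_fun (G N)) 0) \<longlonglongrightarrow> (deriv ^^ k) ?h 0"
      by (rule higher_deriv_complex_uniform_limit[OF ul])
         (auto intro!: always_eventually holomorphic_on_subset[OF hardy_holomorphic])
    then show ?thesis
      unfolding b_def hardy_coeff_def fps_expansion_def by (simp add: tendsto_divide)
  qed
  have bnd: "(\<Sum>k<K. (cmod (b k))\<^sup>2) \<le> (M * norm f)\<^sup>2" for K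
  proof (rule LIMSEQ_le_const2)
    show "(\<lambda>N. \<Sum>k<K. (cmod (hardy_coeff (G N) k))\<^sup>2) \<longlonglongrightarrow> (\<Sum>k<K. (cmod (b k))\<^sup>2)"
      by (intro tendsto_intros lim)
    have "(\<Sum>k<K. (cmod (hardy_coeff (G N) k))\<^sup>2) \<le> (M * norm f)\<^sup>2" for N
      using sum_coeff_le_norm[of "G N" K] power_mono[OF nG[of N], of 2] by simp
    then show "\<exists>N0. \<forall>N\<ge>N0. (\<Sum>k<K. (cmod (hardy_coeff (G N) k))\<^sup>2) \<le> (M * norm f)\<^sup>2"
      by blast
  qed
  have "summable (\<lambda>k. (cmod (b k))\<^sup>2)"
    by (rule summableI_nonneg_bounded[OF _ bnd]) simp
  then obtain g where g: "\<And>z. z \<in> unit_disk \<Longrightarrow> hardy_fun g z = ?h z" "\<And>k. hardy_coeff g k = b k"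
    using hardy_of_function[OF holh] unfolding b_def by metis
  have "norm g \<le> M * norm f"
    by (rule norm_hardy_leI) (use bnd g(2) \<open>M \<ge> 0\<close> in simp_all)
  with g(1) show ?thesis by blast
qed

lemma composition_op_exists:
  assumes hol: "\<phi> holomorphic_on unit_disk" and self: "\<phi> ` unit_disk \<subseteq> unit_disk"
    and M: "M \<ge> 0"
    and bd: "\<And>c N. \<exists>G. (\<forall>z\<in>unit_disk. hardy_fun G z = (\<Sum>n<N. c n * \<phi> z ^ n)) \<and>
                norm G \<le> M * sqrt (\<Sum>n<N. (cmod (c n))\<^sup>2)"
  obtains T where "is_composition_op \<phi> T"
proof -
  have "\<exists>T. \<forall>f. (\<forall>z\<in>unit_disk. hardy_fun (T f) z = hardy_fun f (\<phi> z)) \<and> norm (T f) \<le> M * norm f"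
    by (intro choice allI composition_function_in_hardy[OF hol self M bd])
  then obtain T where T: "\<And>f z. z \<in> unit_disk \<Longrightarrow> hardy_fun (T f) z = hardy_fun f (\<phi> z)"
    and n: "\<And>f. norm (T f) \<le> M * norm f"
    by blast
  have "bounded_linear T"
  proof (rule bounded_linear_intro)
    show "T (f + g) = T f + T g" for f g
      by (rule hardy_fun_eqI) (simp add: T hardy_fun_add)
    show "T (r *\<^sub>R f) = r *\<^sub>R T f" for r f
      by (rule hardy_fun_eqI) (simp add: T scaleR_hardy_eq hardy_fun_scale)
    show "norm (T f) \<le> norm f * M" for f
      using n[of f] by (simp add: mult.commute)
  qed
  then have "is_composition_op \<phi> (Blinfun T)"
    by (simp add: is_composition_op_def bounded_linear_Blinfun_apply T)
  then show ?thesis by (rule that)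
qed

section \<open>A Schur test for powers of a geometric series\<close>

text \<open>
  Cauchy--Schwarz with the weights \<open>sqrt (cmod (e n k))\<close>; only finite sums occur.
\<close>

lemma schur_bound:
  fixes e :: "nat \<Rightarrow> nat \<Rightarrow> complex"
  assumes row: "\<And>k N. (\<Sum>n<N. cmod (e n k)) \<le> r" and col: "\<And>n K. (\<Sum>k<K. cmod (e n k)) \<le> s"
    and "r \<ge> 0"
  shows "(\<Sum>k<K. (cmod (\<Sum>n<N. c n * e n k))\<^sup>2) \<le> r * s * (\<Sum>n<N. (cmod (c n))\<^sup>2)"
proof -
  have "(\<Sum>k<K. (cmod (\<Sum>n<N. c n * e n k))\<^sup>2) \<le> (\<Sum>k<K. r * (\<Sum>n<N. (cmod (c n))\<^sup>2 * cmod (e n k)))"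
  proof (rule sum_mono)
    fix k
    have "cmod (\<Sum>n<N. c n * e n k) \<le> (\<Sum>n<N. cmod (c n * e n k))"
      by (rule norm_sum)
    also have "\<dots> = (\<Sum>n<N. sqrt (cmod (e n k)) * (cmod (c n) * sqrt (cmod (e n k))))"
      by (intro sum.cong) (simp_all add: norm_mult mult_ac real_sqrt_mult_self)
    finally have "(cmod (\<Sum>n<N. c n * e n k))\<^sup>2 \<le>
        (\<Sum>n<N. sqrt (cmod (e n k)) * (cmod (c n) * sqrt (cmod (e n k))))\<^sup>2"
      by (rule power_mono) simp
    also have "\<dots> \<le> (\<Sum>n<N. (sqrt (cmod (e n k)))\<^sup>2) * (\<Sum>n<N. (cmod (c n) * sqrt (cmod (e n k)))\<^sup>2)"
      by (rule Cauchy_Schwarz_ineq_sum)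
    also have "\<dots> = (\<Sum>n<N. cmod (e n k)) * (\<Sum>n<N. (cmod (c n))\<^sup>2 * cmod (e n k))"
      by (simp add: power_mult_distrib)
    also have "\<dots> \<le> r * (\<Sum>n<N. (cmod (c n))\<^sup>2 * cmod (e n k))"
      by (intro mult_right_mono row sum_nonneg) simp
    finally show "(cmod (\<Sum>n<N. c n * e n k))\<^sup>2 \<le> r * (\<Sum>n<N. (cmod (c n))\<^sup>2 * cmod (e n k))" .
  qed
  also have "\<dots> = r * (\<Sum>n<N. (cmod (c n))\<^sup>2 * (\<Sum>k<K. cmod (e n k)))"
    unfolding sum_distrib_left[symmetric] by (subst sum.swap) (simp add: sum_distrib_left)
  also have "\<dots> \<le> r * (\<Sum>n<N. (cmod (c n))\<^sup>2 * s)"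
    using \<open>r \<ge> 0\<close> by (intro mult_left_mono sum_mono col) auto
  finally show ?thesis by (simp add: sum_distrib_left mult_ac)
qed

text \<open>
  Here \<open>P = t X / (1 - q X)\<close>, and for \<open>q = 1 - t\<close> the coefficient of \<open>X\<^sup>k\<close> in \<open>P\<^sup>n\<close> is the probability
  that the \<open>n\<close>-th success in independent trials with success probability \<open>t\<close> occurs at trial \<open>k\<close>. The sum over
  \<open>k\<close> is then a total probability, and the sum over \<open>n \<ge> 1\<close> is the probability of a success at trial \<open>k\<close>.
  The recursion given by \<open>P\<^sup>n\<^sup>+\<^sup>1 (1 - q X) = t X P\<^sup>n\<close> yields both bounds without binomial coefficients.
\<close>

lemma geometric_fps_bounds:
  fixes P :: "complex fps"
  assumes P: "P * (1 - fps_const q * fps_X) = fps_const (of_real t) * fps_X"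
    and q: "cmod q = 1 - t" and t: "0 < t" "t \<le> 1"
  shows "(\<Sum>n<N. cmod (fps_nth (P ^ Suc n) k)) \<le> t"
    and "(\<Sum>k<K. cmod (fps_nth (P ^ n) k)) \<le> 1"
proof -
  define e where "e n k = cmod (fps_nth (P ^ n) k)" for n k
  have P': "P ^ Suc n = P ^ Suc n * (fps_const q * fps_X) + P ^ n * (fps_const (of_real t) * fps_X)" for n
  proof -
    have "P ^ Suc n - P ^ Suc n * (fps_const q * fps_X) = P ^ n * (P * (1 - fps_const q * fps_X))"
      by (simp add: algebra_simps)
    also have "\<dots> = P ^ n * (fps_const (of_real t) * fps_X)"
      by (simp only: P)
    finally show ?thesis by (simp only: diff_eq_eq add.commute)
  qed
  have z: "fps_nth (P ^ Suc n) 0 = 0" for n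
    by (subst P') simp
  have s: "fps_nth (P ^ Suc n) (Suc k) = q * fps_nth (P ^ Suc n) k + of_real t * fps_nth (P ^ n) k" for n k
  proof -
    have "fps_nth (P ^ Suc n) (Suc k) = fps_nth (fps_const q * (P ^ Suc n * fps_X)
            + fps_const (of_real t) * (P ^ n * fps_X)) (Suc k)"
      by (subst P') (simp only: mult_ac)
    then show ?thesis by (simp del: power_Suc)
  qed
  have e0: "e (Suc n) 0 = 0" for n
    unfolding e_def by (simp only: z) simp
  have eS: "e (Suc n) (Suc k) \<le> (1 - t) * e (Suc n) k + t * e n k" for n k
    unfolding e_def s using t
    by (intro order_trans[OF norm_triangle_ineq]) (simp add: norm_mult q del: power_Suc)
  have e00: "e 0 k = (if k = 0 then 1 else 0)" for k
    by (simp add: e_def)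
  have row: "(\<Sum>n<N. e (Suc n) k) \<le> t" for N k
  proof (induction k)
    case 0
    then show ?case using t by (simp add: e0)
  next
    case (Suc k)
    have "(\<Sum>n<N. e n k) \<le> (\<Sum>n<Suc N. e n k)"
      by (simp add: e_def)
    also have "\<dots> = e 0 k + (\<Sum>n<N. e (Suc n) k)"
      by (rule sum.lessThan_Suc_shift)
    also have "\<dots> \<le> 1"
    proof (cases "k = 0")
      case False
      then show ?thesis using Suc.IH t by (simp add: e00)
    qed (simp add: e00 e0)
    finally have *: "(\<Sum>n<N. e n k) \<le> 1" .
    have **: "k = 0 \<Longrightarrow> (\<Sum>n<N. e (Suc n) k) = 0"
      by (simp add: e0)
    have "(\<Sum>n<N. e (Suc n) (Suc k)) \<le> (\<Sum>n<N. (1 - t) * e (Suc n) k + t * e n k)"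
      by (intro sum_mono eS)
    also have "\<dots> = (1 - t) * (\<Sum>n<N. e (Suc n) k) + t * (\<Sum>n<N. e n k)"
      by (simp add: sum.distrib sum_distrib_left)
    also have "\<dots> \<le> t"
    proof (cases "k = 0")
      case True
      then show ?thesis using ** * t by (simp add: mult_left_le)
    next
      case False
      have "(\<Sum>n<N. e n k) \<le> (\<Sum>n<N. e (Suc n) k)" 
      proof (cases N)
        case (Suc N')
        then have "(\<Sum>n<N. e n k) = (\<Sum>n<N'. e (Suc n) k)"
          using False by (simp add: sum.lessThan_Suc_shift e00 del: sum.lessThan_Suc)
        also have "\<dots> \<le> (\<Sum>n<N. e (Suc n) k)" using Suc by (simp add: e_def)
        finally show ?thesis .
      qed simp
      then have "(1 - t) * (\<Sum>n<N. e (Suc n) k) + t * (\<Sum>n<N. e n k) \<le>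
            (1 - t) * (\<Sum>n<N. e (Suc n) k) + t * (\<Sum>n<N. e (Suc n) k)"
        using t by simp
      also have "\<dots> = (\<Sum>n<N. e (Suc n) k)" by (simp add: algebra_simps)
      finally show ?thesis using Suc.IH by simp
    qed
    finally show ?case .
  qed
  have col: "(\<Sum>k<K. e n k) \<le> 1" for n K
  proof (induction n)
    case 0
    show ?case by (simp add: e00)
  next
    case (Suc n)
    show ?case
    proof (cases K)
      case (Suc K')
      have le: "(\<Sum>k<K'. e m k) \<le> (\<Sum>k<K. e m k)" for m
        using Suc by (simp add: e_def)
      let ?C = "\<Sum>k<K. e (Suc n) k"
      have "?C = (\<Sum>k<K'. e (Suc n) (Suc k))"
        using Suc by (simp add: sum.lessThan_Suc_shift e0 del: sum.lessThan_Suc)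
      also have "\<dots> \<le> (\<Sum>k<K'. (1 - t) * e (Suc n) k + t * e n k)"
        by (intro sum_mono eS)
      also have "\<dots> = (1 - t) * (\<Sum>k<K'. e (Suc n) k) + t * (\<Sum>k<K'. e n k)"
        by (simp add: sum.distrib sum_distrib_left)
      also have "\<dots> \<le> (1 - t) * ?C + t * (\<Sum>k<K. e n k)"
        using t by (intro add_mono mult_left_mono le) auto
      finally have "t * ?C \<le> t * (\<Sum>k<K. e n k)"
        by (simp add: algebra_simps)
      then show ?thesis using t Suc.IH by simp
    qed simp
  qed
  show "(\<Sum>n<N. cmod (fps_nth (P ^ Suc n) k)) \<le> t"
    using row unfolding e_def .
  show "(\<Sum>k<K. cmod (fps_nth (P ^ n) k)) \<le> 1"
    using col unfolding e_def .
qed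

section \<open>Multiplication by affine functions, and disk automorphisms\<close>

lemma hardy_inner_scale_right: "hardy_inner f (hardy_scale c g) = cnj c * hardy_inner f g"
  by (subst hardy_inner_commute, subst hardy_inner_scale_left)
     (simp add: hardy_inner_commute[of g f])

lemma fun_affine:
  assumes "z \<in> unit_disk"
  shows "hardy_fun (hardy_scale c (shift g) + hardy_scale d g) z = (c * z + d) * hardy_fun g z"
  using assms by (simp add: hardy_fun_add hardy_fun_scale fun_shift algebra_simps)

lemma norm_affine_le:
  "norm (hardy_scale c (shift g) + hardy_scale d g) \<le> (cmod c + cmod d) * norm g"
  by (rule order_trans[OF norm_triangle_ineq]) (simp add: norm_hardy_scale norm_shift algebra_simps)

text \<open>
  On the unit circle \<open>cnj d z + cnj c\<close> and \<open>c z + d\<close> have the same modulus, so multiplication by either has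
  the same effect on norms. Expanding the squares proves this without boundary values, because
  multiplication by \<open>z\<close> is an isometry and both cross terms are \<open>Re (c cnj d \<langle>z g, g\<rangle>)\<close>.
\<close>

lemma norm_affine_reflected:
  "norm (hardy_scale (cnj d) (shift g) + hardy_scale (cnj c) g) =
   norm (hardy_scale c (shift g) + hardy_scale d g)"
proof -
  have sq: "(norm (hardy_scale a (shift g) + hardy_scale b g))\<^sup>2 =
      ((cmod a)\<^sup>2 + (cmod b)\<^sup>2) * (norm g)\<^sup>2 + 2 * Re (a * cnj b * hardy_inner (shift g) g)" for a b
  proof -
    have "(norm (x + y))\<^sup>2 = (norm x)\<^sup>2 + (norm y)\<^sup>2 + 2 * inner x y" for x y :: hardy
      by (simp add: power2_norm_eq_inner inner_add_left inner_add_right inner_commute[of y x])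
    note this[of "hardy_scale a (shift g)" "hardy_scale b g"]
    also have "inner (hardy_scale a (shift g)) (hardy_scale b g) = Re (a * cnj b * hardy_inner (shift g) g)"
      by (simp add: inner_hardy_def hardy_inner_scale_left hardy_inner_scale_right mult_ac
               del: times_complex.sel)
    finally show ?thesis
      by (simp add: norm_hardy_scale norm_shift power_mult_distrib distrib_right del: times_complex.sel)
  qed
  have "(norm (hardy_scale (cnj d) (shift g) + hardy_scale (cnj c) g))\<^sup>2 =
        (norm (hardy_scale c (shift g) + hardy_scale d g))\<^sup>2"
    unfolding sq by (simp add: mult.commute[of "cnj d"] del: times_complex.sel)
  then show ?thesis by simp
qed

text \<open>
  The zero of \<open>c z + d\<close> lies outside the closed disk, so division by it preserves the Hardy space. The
  coefficients of the quotient satisfy \<open>d a\<^sub>n\<^sub>+\<^sub>1 = h\<^sub>n\<^sub>+\<^sub>1 - c a\<^sub>n\<close>, and the triangle inequality for partial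
  sums gives \<open>(cmod d - cmod c) * L2 a \<le> norm h\<close>.
\<close>

lemma hardy_divide_affine:
  assumes cd: "cmod c < cmod d"
  obtains g where "hardy_scale c (shift g) + hardy_scale d g = h"
proof -
  have d: "d \<noteq> 0" using cd by auto
  define a where "a = rec_nat (hardy_coeff h 0 / d) (\<lambda>n x. (hardy_coeff h (Suc n) - c * x) / d)"
  have a0: "d * a 0 = hardy_coeff h 0" and aS: "d * a (Suc n) = hardy_coeff h (Suc n) - c * a n" for n
    using d by (simp_all add: a_def)
  let ?L = "\<lambda>K. L2_set (\<lambda>n. cmod (a n)) {..<K}"
  have Lbd: "(cmod d - cmod c) * ?L K \<le> norm h" for K
  proof -
    let ?s = "\<lambda>n. case n of 0 \<Rightarrow> 0 | Suc k \<Rightarrow> cmod (a k)"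
    have "cmod d * ?L K = L2_set (\<lambda>n. cmod d * cmod (a n)) {..<K}"
      by (rule L2_set_right_distrib) simp
    also have "\<dots> \<le> L2_set (\<lambda>n. cmod (hardy_coeff h n) + cmod c * ?s n) {..<K}"
    proof (rule L2_set_mono)
      fix n
      show "cmod d * cmod (a n) \<le> cmod (hardy_coeff h n) + cmod c * ?s n"
        using a0 aS norm_triangle_ineq4
        by (cases n) (simp_all add: norm_mult[symmetric])
    qed simp
    also have "\<dots> \<le> L2_set (\<lambda>n. cmod (hardy_coeff h n)) {..<K} + L2_set (\<lambda>n. cmod c * ?s n) {..<K}"
      by (rule L2_set_triangle_ineq)
    also have "L2_set (\<lambda>n. cmod c * ?s n) {..<K} = cmod c * L2_set ?s {..<K}"
      by (rule L2_set_right_distrib[symmetric]) simp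
    finally have 1: "cmod d * ?L K \<le> L2_set (\<lambda>n. cmod (hardy_coeff h n)) {..<K} + cmod c * L2_set ?s {..<K}" .
    have "L2_set ?s {..<K} \<le> ?L K"
    proof (cases K)
      case (Suc K')
      then show ?thesis
        unfolding L2_set_def
        by (subst Suc, subst sum.lessThan_Suc_shift) simp
    qed simp
    then have "cmod c * L2_set ?s {..<K} \<le> cmod c * ?L K"
      by (rule mult_left_mono) simp
    moreover have "L2_set (\<lambda>n. cmod (hardy_coeff h n)) {..<K} \<le> norm h"
      unfolding L2_set_def by (rule real_le_lsqrt) (simp_all add: sum_coeff_le_norm)
    ultimately show ?thesis using 1 by (simp add: algebra_simps)
  qed
  have "summable (\<lambda>n. (cmod (a n))\<^sup>2)"
  proof (rule summableI_nonneg_bounded)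
    fix K
    have "?L K \<le> norm h / (cmod d - cmod c)"
      using Lbd[of K] cd by (simp add: field_simps)
    then have "(?L K)\<^sup>2 \<le> (norm h / (cmod d - cmod c))\<^sup>2"
      by (rule power_mono) simp
    then show "(\<Sum>n<K. (cmod (a n))\<^sup>2) \<le> (norm h / (cmod d - cmod c))\<^sup>2"
      by (simp add: L2_set_def sum_nonneg)
  qed simp
  then obtain g where g: "\<And>n. hardy_coeff g n = a n" using hardy_of_coeffs by blast
  have "hardy_scale c (shift g) + hardy_scale d g = h"
  proof (rule hardy_eqI)
    show "hardy_coeff (hardy_scale c (shift g) + hardy_scale d g) n = hardy_coeff h n" for n
      using a0 aS by (cases n) (simp_all add: hardy_coeff_add hardy_coeff_scale coeff_shift g)
  qed
  then show ?thesis by (rule that)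
qed

text \<open>
  With \<open>\<alpha> = (cnj d z + cnj c) / (c z + d)\<close> and \<open>U = 1 / (c z + d)\<close>, the functions \<open>\<alpha>\<^sup>n U\<close> are orthogonal
  and have the norm of \<open>U\<close>. In the induction a polynomial in \<open>\<alpha>\<close> splits as a constant plus a multiple
  of \<open>\<alpha>\<close>: multiplication by \<open>\<alpha>\<close> is isometric, and \<open>U\<close> is a multiple of the reproducing kernel at the
  zero of \<open>\<alpha>\<close>, so that the two parts are orthogonal.
\<close>

lemma automorphism_polynomial_norm:
  assumes cd: "cmod c < cmod d"
    and U: "hardy_scale c (shift U) + hardy_scale d U = hardy_monom 0"
  shows "\<exists>G. (\<forall>z\<in>unit_disk. (c * z + d) * hardy_fun G z = (\<Sum>n<N. a n * ((cnj d * z + cnj c) / (c * z + d)) ^ n))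
           \<and> (norm G)\<^sup>2 = (norm U)\<^sup>2 * (\<Sum>n<N. (cmod (a n))\<^sup>2)"
proof (induction N arbitrary: a)
  case 0
  show ?case by (intro exI[of _ 0]) (simp add: hardy_fun_zero)
next
  case (Suc N)
  let ?\<alpha> = "\<lambda>z. (cnj d * z + cnj c) / (c * z + d)"
  have d: "d \<noteq> 0" using cd by auto
  have nz: "c * z + d \<noteq> 0" if "z \<in> unit_disk" for z
  proof
    assume "c * z + d = 0"
    then have "cmod d = cmod c * cmod z"
      by (metis add_eq_0_iff norm_minus_cancel norm_mult)
    then show False using cd that mult_left_le[of "cmod z" "cmod c"] by simp
  qed
  obtain G where G: "\<And>z. z \<in> unit_disk \<Longrightarrow> (c * z + d) * hardy_fun G z = (\<Sum>n<N. a (Suc n) * ?\<alpha> z ^ n)"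
    "(norm G)\<^sup>2 = (norm U)\<^sup>2 * (\<Sum>n<N. (cmod (a (Suc n)))\<^sup>2)"
    using Suc.IH[of "\<lambda>n. a (Suc n)"] by blast
  obtain g where g: "hardy_scale c (shift g) + hardy_scale d g = G"
    using hardy_divide_affine[OF cd] .
  define H where "H = hardy_scale (cnj d) (shift g) + hardy_scale (cnj c) g"
  have nH: "norm H = norm G"
    unfolding H_def norm_affine_reflected g ..
  have fH: "hardy_fun H z = (cnj d * z + cnj c) * hardy_fun g z" 
       "hardy_fun G z = (c * z + d) * hardy_fun g z" if "z \<in> unit_disk" for z
    using fun_affine[OF that] g H_def by auto
  have Un: "hardy_coeff U n = (- c / d) ^ n / d" for n
  proof (induction n)
    case 0
    have "hardy_coeff (hardy_scale c (shift U) + hardy_scale d U) 0 = 1"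
      unfolding U by (simp add: coeff_monom)
    then show ?case using d by (simp add: hardy_coeff_add hardy_coeff_scale coeff_shift field_simps)
  next
    case (Suc n)
    have "hardy_coeff (hardy_scale c (shift U) + hardy_scale d U) (Suc n) = 0"
      unfolding U by (simp add: coeff_monom)
    then have "hardy_coeff U (Suc n) = (- c / d) * hardy_coeff U n"
      using d by (simp add: hardy_coeff_add hardy_coeff_scale coeff_shift field_simps add_eq_0_iff)
    then show ?case using Suc.IH by simp
  qed
  \<comment> \<open>The coefficients of \<open>U\<close> are those of the reproducing kernel at \<open>p\<close>, up to a constant factor.\<close>
  define p where "p = cnj (- c / d)"
  have p: "p \<in> unit_disk" using cd d by (simp add: p_def norm_divide)
  have "hardy_inner H U = (\<Sum>n. cnj (1 / d) * (hardy_coeff H n * p ^ n))"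
    unfolding hardy_inner_def by (intro suminf_cong) (simp add: Un p_def mult_ac)
  also have "\<dots> = cnj (1 / d) * hardy_fun H p"
    using sums_unique[OF sums_mult[OF hardy_sums[OF p, of H]], of "cnj (1/d)"] by simp
  also have "hardy_fun H p = 0"
    unfolding fH(1)[OF p] using d by (simp add: p_def)
  finally have orth: "hardy_inner H U = 0" by simp
  define G' where "G' = hardy_scale (a 0) U + H"
  have "(norm G')\<^sup>2 = (norm (hardy_scale (a 0) U))\<^sup>2 + (norm H)\<^sup>2 + 2 * inner H (hardy_scale (a 0) U)"
    unfolding G'_def by (simp add: power2_norm_eq_inner inner_add_left inner_add_right inner_commute)
  also have "inner H (hardy_scale (a 0) U) = 0"
    by (simp add: inner_hardy_def hardy_inner_scale_right orth)
  finally have "(norm G')\<^sup>2 = (norm U)\<^sup>2 * (\<Sum>n<Suc N. (cmod (a n))\<^sup>2)"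
    unfolding nH G(2) by (subst sum.lessThan_Suc_shift) (simp add: norm_hardy_scale power_mult_distrib algebra_simps)
  moreover have "(c * z + d) * hardy_fun G' z = (\<Sum>n<Suc N. a n * ?\<alpha> z ^ n)" if z: "z \<in> unit_disk" for z
  proof -
    have "(c * z + d) * hardy_fun U z = 1"
      using fun_affine[OF z, of c U d] fun_monom[OF z, of 0] by (simp add: U)
    moreover have "(c * z + d) * hardy_fun H z = ?\<alpha> z * ((c * z + d) * hardy_fun G z)"
      using nz[OF z] by (simp add: fH[OF z])
    moreover have "(c * z + d) * hardy_fun G' z =
        a 0 * ((c * z + d) * hardy_fun U z) + (c * z + d) * hardy_fun H z"
      by (simp add: G'_def hardy_fun_add hardy_fun_scale algebra_simps)
    ultimately have "(c * z + d) * hardy_fun G' z = a 0 + ?\<alpha> z * (\<Sum>n<N. a (Suc n) * ?\<alpha> z ^ n)"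
      by (simp only: G(1)[OF z] mult_1_right)
    then show ?thesis
      by (subst sum.lessThan_Suc_shift) (simp add: sum_distrib_left mult_ac)
  qed
  ultimately show ?case by blast
qed

section \<open>Affine maps of the half-plane\<close>

text \<open>
  This is the map \<open>w \<mapsto> t w + b\<close> in the coordinate \<open>w = (\<zeta> + z) / (\<zeta> - z)\<close>.
\<close>

definition hp_affine :: "complex \<Rightarrow> real \<Rightarrow> complex \<Rightarrow> complex \<Rightarrow> complex" where
  "hp_affine \<zeta> t b = moebius (t - b + 1) ((t + b - 1) * \<zeta>) ((t - b - 1) * cnj \<zeta>) (t + b + 1)"

lemma moebius_has_field_derivative:
  assumes "c * z + d \<noteq> (0 :: complex)"
  shows "(moebius a b c d has_field_derivative (a * d - b * c) / (c * z + d)\<^sup>2) (at z)"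
proof -
  have "((\<lambda>z. (a * z + b) / (c * z + d)) has_field_derivative
          (a * (c * z + d) - (a * z + b) * c) / ((c * z + d) * (c * z + d))) (at z)"
    by (rule derivative_eq_intros refl assms | simp)+
  then show ?thesis
    by (simp add: moebius_def power2_eq_square algebra_simps)
qed

text \<open>
  Up to the factor \<open>4 (cmod (\<zeta> - z))\<^sup>2\<close> this is the identity \<open>Re (t w + b) = t Re w + Re b\<close>; it controls
  where the map sends the disk.
\<close>

lemma hp_affine_boundary_identity:
  fixes t :: real and \<zeta> b z :: complex
  assumes "cmod \<zeta> = 1"
  shows "(cmod ((t - b - 1) * cnj \<zeta> * z + (t + b + 1)))\<^sup>2 - (cmod ((t - b + 1) * z + (t + b - 1) * \<zeta>))\<^sup>2
    = 4 * (t * (1 - (cmod z)\<^sup>2) + Re b * (cmod (\<zeta> - z))\<^sup>2)" (is "?L = _")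
proof -
  define x where "x = cnj \<zeta> * z"
  have z: "z = \<zeta> * x"
    using assms complex_norm_square[of \<zeta>] by (simp add: x_def)
  have "?L = (cmod ((t - b - 1) * x + (t + b + 1)))\<^sup>2 - (cmod (\<zeta> * ((t - b + 1) * x + (t + b - 1))))\<^sup>2"
    unfolding x_def[symmetric] mult.assoc by (simp add: z algebra_simps)
  also have "\<dots> = (cmod ((t - b - 1) * x + (t + b + 1)))\<^sup>2 - (cmod ((t - b + 1) * x + (t + b - 1)))\<^sup>2"
    using assms by (simp add: norm_mult)
  also have "\<dots> = 4 * (t * (1 - (cmod x)\<^sup>2) + Re b * (cmod (1 - x))\<^sup>2)"
    unfolding cmod_power2 by (simp add: power2_eq_square algebra_simps)
  also have "cmod x = cmod z" using assms by (simp add: z norm_mult)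
  also have "cmod (1 - x) = cmod (\<zeta> - z)"
  proof -
    have "\<zeta> - z = \<zeta> * (1 - x)" by (simp add: z algebra_simps)
    then show ?thesis using assms by (simp add: norm_mult)
  qed
  finally show ?thesis .
qed

lemma
  fixes t :: real and \<zeta> b z :: complex
  assumes "cmod \<zeta> = 1" "t > 0" "Re b \<ge> 0" "z \<in> unit_disk"
  shows hp_affine_den_nz: "(t - b - 1) * cnj \<zeta> * z + (t + b + 1) \<noteq> 0"
    and hp_affine_in_disk: "hp_affine \<zeta> t b z \<in> unit_disk"
proof -
  let ?N = "(t - b + 1) * z + (t + b - 1) * \<zeta>" and ?D = "(t - b - 1) * cnj \<zeta> * z + (t + b + 1)"
  have "(cmod z)\<^sup>2 < 1" using assms(4) by (simp add: abs_square_less_1)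
  then have "t * (1 - (cmod z)\<^sup>2) + Re b * (cmod (\<zeta> - z))\<^sup>2 > 0"
    using assms by (intro add_pos_nonneg) auto
  then have "(cmod ?N)\<^sup>2 < (cmod ?D)\<^sup>2"
    using hp_affine_boundary_identity[OF assms(1), of t b z] by simp
  then have lt: "cmod ?N < cmod ?D" by (rule power2_less_imp_less) simp
  then show "?D \<noteq> 0" by auto
  with lt show "hp_affine \<zeta> t b z \<in> unit_disk"
    by (simp add: hp_affine_def moebius_def norm_divide)
qed

lemma hp_affine_image: "cmod \<zeta> = 1 \<Longrightarrow> t > 0 \<Longrightarrow> Re b \<ge> 0 \<Longrightarrow> hp_affine \<zeta> t b ` unit_disk \<subseteq> unit_disk"
  using hp_affine_in_disk by blast

lemma hp_affine_holomorphic: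
  fixes t :: real and \<zeta> b :: complex
  assumes "cmod \<zeta> = 1" "t > 0" "Re b \<ge> 0"
  shows "hp_affine \<zeta> t b holomorphic_on unit_disk"
  unfolding hp_affine_def moebius_def using hp_affine_den_nz[OF assms]
  by (intro holomorphic_intros) auto

lemma affine_cancel: "D \<noteq> 0 \<Longrightarrow> (p * (N / D) + q) * D = p * N + q * D" for D :: complex
  by (simp add: field_simps)

lemma hp_affine_compose:
  fixes t t' :: real and \<zeta> b b' z :: complex
  assumes \<zeta>: "cmod \<zeta> = 1" and "t > 0" "Re b \<ge> 0" "t' > 0" "Re b' \<ge> 0" and z: "z \<in> unit_disk"
  shows "hp_affine \<zeta> t b (hp_affine \<zeta> t' b' z) = hp_affine \<zeta> (t * t') (t * b' + b) z"
proof -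
  have h: "\<zeta> * cnj \<zeta> = 1" using \<zeta> complex_norm_square[of \<zeta>] by simp
  let ?N = "(t' - b' + 1) * z + (t' + b' - 1) * \<zeta>" and ?D = "(t' - b' - 1) * cnj \<zeta> * z + (t' + b' + 1)"
  have D: "?D \<noteq> 0" using hp_affine_den_nz assms by blast
  let ?n = "(t - b + 1) * (?N / ?D) + (t + b - 1) * \<zeta>" and ?d = "(t - b - 1) * cnj \<zeta> * (?N / ?D) + (t + b + 1)"
  have "hp_affine \<zeta> t b (hp_affine \<zeta> t' b' z) = ?n / ?d"
    by (simp add: hp_affine_def moebius_def)
  also have "\<dots> = (?n * ?D) / (?d * ?D)"
    using D by simp
  also have "?n * ?D = (t - b + 1) * ?N + (t + b - 1) * \<zeta> * ?D"
    by (rule affine_cancel[OF D])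
  also have "?d * ?D = (t - b - 1) * cnj \<zeta> * ?N + (t + b + 1) * ?D"
    by (rule affine_cancel[OF D])
  also have "(t - b + 1) * ?N + (t + b - 1) * \<zeta> * ?D =
      2 * (((t * t') - (t * b' + b) + 1) * z + ((t * t') + (t * b' + b) - 1) * \<zeta>)"
    unfolding of_real_mult using h by algebra
  also have "(t - b - 1) * cnj \<zeta> * ?N + (t + b + 1) * ?D =
      2 * (((t * t') - (t * b' + b) - 1) * cnj \<zeta> * z + ((t * t') + (t * b' + b) + 1))"
    unfolding of_real_mult using h by algebra
  finally have "hp_affine \<zeta> t b (hp_affine \<zeta> t' b' z) =
      (2 * (((t * t') - (t * b' + b) + 1) * z + ((t * t') + (t * b' + b) - 1) * \<zeta>)) /
      (2 * (((t * t') - (t * b' + b) - 1) * cnj \<zeta> * z + ((t * t') + (t * b' + b) + 1)))" .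
  then show ?thesis
    unfolding hp_affine_def moebius_def by (simp only: mult_divide_mult_cancel_left_if) simp
qed

lemma hp_affine_det:
  fixes t :: real and \<zeta> b :: complex
  assumes "cmod \<zeta> = 1"
  shows "(t - b + 1) * (t + b + 1) - ((t + b - 1) * \<zeta>) * ((t - b - 1) * cnj \<zeta>) = 4 * complex_of_real t"
proof -
  have h: "\<zeta> * cnj \<zeta> = 1" using assms complex_norm_square[of \<zeta>] by simp
  show ?thesis using h by algebra
qed

lemma
  fixes t :: real and \<zeta> b :: complex
  assumes "cmod \<zeta> = 1" "t > 0"
  shows hp_affine_fixes: "hp_affine \<zeta> t b \<zeta> = \<zeta>"
    and hp_affine_deriv: "(hp_affine \<zeta> t b has_field_derivative 1 / of_real t) (at \<zeta>)"
proof -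
  have h: "\<zeta> * cnj \<zeta> = 1" using assms complex_norm_square[of \<zeta>] by simp
  have den: "(t - b - 1) * cnj \<zeta> * \<zeta> + (t + b + 1) = 2 * of_real t"
    using h by algebra
  have num: "(t - b + 1) * \<zeta> + (t + b - 1) * \<zeta> = 2 * of_real t * \<zeta>"
    by (simp add: algebra_simps)
  show "hp_affine \<zeta> t b \<zeta> = \<zeta>"
    using assms(2) by (simp add: hp_affine_def moebius_def num den)
  have t: "complex_of_real t \<noteq> 0" using assms(2) by simp
  have "(t - b - 1) * cnj \<zeta> * \<zeta> + (t + b + 1) \<noteq> 0"
    unfolding den using t by simp
  from moebius_has_field_derivative[OF this, of "t - b + 1" "(t + b - 1) * \<zeta>"]
  show "(hp_affine \<zeta> t b has_field_derivative 1 / of_real t) (at \<zeta>)"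
    unfolding hp_affine_det[OF assms(1)] den hp_affine_def[symmetric]
    using t by (simp add: power2_eq_square)
qed

text \<open>
  The image lies in the half-plane \<open>Re w > Re b\<close>, so it misses the point with coordinate \<open>w = Re b\<close>, which is
  \<open>z = \<zeta> (Re b - 1) / (Re b + 1)\<close>.
\<close>

lemma hp_affine_not_onto:
  fixes t :: real and \<zeta> b :: complex
  assumes \<zeta>: "cmod \<zeta> = 1" and t: "t > 0" and b: "Re b > 0"
  shows "\<not> unit_disk \<subseteq> hp_affine \<zeta> t b ` unit_disk"
proof
  assume sub: "unit_disk \<subseteq> hp_affine \<zeta> t b ` unit_disk"
  define \<beta> where "\<beta> = Re b"
  have h: "\<zeta> * cnj \<zeta> = 1" using \<zeta> complex_norm_square[of \<zeta>] by simp
  have "\<zeta> * of_real ((\<beta> - 1) / (\<beta> + 1)) \<in> unit_disk"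
    using b \<zeta> by (simp add: norm_mult \<beta>_def abs_if field_simps del: of_real_divide)
  then obtain z where z: "z \<in> unit_disk" "hp_affine \<zeta> t b z = \<zeta> * of_real ((\<beta> - 1) / (\<beta> + 1))"
    using sub by (metis imageE subsetD)
  let ?N = "(t - b + 1) * z + (t + b - 1) * \<zeta>" and ?D = "(t - b - 1) * cnj \<zeta> * z + (t + b + 1)"
  have nz: "?D \<noteq> 0" using hp_affine_den_nz[OF \<zeta> t _ z(1)] b by simp
  have b1: "complex_of_real (\<beta> + 1) \<noteq> 0" using b unfolding \<beta>_def by (subst of_real_eq_0_iff) simp
  have "?N / ?D = \<zeta> * of_real (\<beta> - 1) / of_real (\<beta> + 1)"
    using z(2) by (simp add: hp_affine_def moebius_def)
  then have eq: "?N * of_real (\<beta> + 1) = \<zeta> * of_real (\<beta> - 1) * ?D"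
    by (rule iffD1[OF frac_eq_eq[OF nz b1]])
  define x where "x = cnj \<zeta> * z"
  have zx: "z = \<zeta> * x" using h by (simp add: x_def)
  have "2 * \<zeta> * (of_real t * (1 + x) + (b - of_real \<beta>) * (1 - x)) = 0"
    using eq h zx unfolding of_real_add of_real_diff of_real_1 by algebra
  then have "of_real t * (1 + x) + (b - of_real \<beta>) * (1 - x) = 0"
    using h by auto
  then have "Re ((of_real t * (1 + x) + (b - of_real \<beta>) * (1 - x)) * cnj (1 - x)) = 0"
    by simp
  moreover have "Re ((of_real t * (1 + x) + (b - of_real \<beta>) * (1 - x)) * cnj (1 - x)) = t * (1 - (cmod x)\<^sup>2)"
    unfolding cmod_power2 by (simp add: \<beta>_def power2_eq_square algebra_simps)
  ultimately have "(cmod x)\<^sup>2 = 1" using t by simp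
  moreover have "cmod x < 1" using z(1) \<zeta> by (simp add: x_def norm_mult)
  ultimately show False by (simp add: abs_square_eq_1 power2_eq_1_iff)
qed

lemma hp_affine_lin_frac_self_map:
  fixes t :: real and \<zeta> b :: complex
  assumes "cmod \<zeta> = 1" "t > 0" "Re b \<ge> 0"
  shows "lin_frac_self_map (hp_affine \<zeta> t b)"
  unfolding lin_frac_self_map_def
proof (intro conjI exI)
  show "hp_affine \<zeta> t b = moebius (t - b + 1) ((t + b - 1) * \<zeta>) ((t - b - 1) * cnj \<zeta>) (t + b + 1)"
    by (rule hp_affine_def)
  show "(t - b + 1) * (t + b + 1) - ((t + b - 1) * \<zeta>) * ((t - b - 1) * cnj \<zeta>) \<noteq> 0"
    using hp_affine_det[OF assms(1)] assms(2) by simp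
  show "\<forall>z\<in>unit_disk. (t - b - 1) * cnj \<zeta> * z + (t + b + 1) \<noteq> 0"
    using hp_affine_den_nz assms by blast
qed (rule hp_affine_image[OF assms])

lemma hp_affine_nonauto:
  fixes t :: real and \<zeta> b :: complex
  assumes "cmod \<zeta> = 1" "t > 0" "Re b > 0"
  shows "lin_frac_nonauto (hp_affine \<zeta> t b)"
  using hp_affine_lin_frac_self_map[OF assms(1,2), of b] hp_affine_not_onto[OF assms] assms(3)
  by (auto simp: lin_frac_nonauto_def bij_betw_def)

section \<open>Boundedness of the composition operators\<close>

text \<open>
  The map \<open>w \<mapsto> t w + (1 - t)\<close> fixes the origin \<open>w = 1\<close>. The factor \<open>sqrt t\<close> on functions vanishing there is
  what makes these operators converge to a rank-one operator as \<open>t\<close> tends to 0.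
\<close>

lemma contraction_op:
  fixes t :: real and \<zeta> :: complex
  assumes \<zeta>: "cmod \<zeta> = 1" and t: "0 < t" "t \<le> 1"
  obtains T where "is_composition_op (hp_affine \<zeta> t (of_real (1 - t))) T"
    and "\<And>f. hardy_coeff f 0 = 0 \<Longrightarrow> norm (blinfun_apply T f) \<le> sqrt t * norm f"
proof -
  let ?\<phi> = "hp_affine \<zeta> t (of_real (1 - t))"
  define q where "q = of_real (1 - t) * cnj \<zeta>"
  define P where "P = fps_const (of_real t) * fps_X / (1 - fps_const q * fps_X)"
  have h: "?\<phi> holomorphic_on unit_disk" "?\<phi> ` unit_disk \<subseteq> unit_disk"
    using hp_affine_holomorphic[OF \<zeta>] hp_affine_image[OF \<zeta>] t by auto
  have nz: "1 - q * z \<noteq> 0" if "z \<in> unit_disk" for z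
  proof -
    have "cmod (q * z) \<le> cmod z" using t \<zeta> by (simp add: q_def norm_mult mult_left_le_one_le del: of_real_diff)
    then have "cmod (q * z) < 1" using that by simp
    then show ?thesis by auto
  qed
  have \<phi>: "?\<phi> z = of_real t * z / (1 - q * z)" if "z \<in> unit_disk" for z
  proof -
    have "?\<phi> z = (2 * (of_real t * z)) / (2 * (1 - q * z))"
      unfolding hp_affine_def moebius_def q_def by (simp add: algebra_simps)
    then show ?thesis by (simp only: mult_divide_mult_cancel_left_if) simp
  qed
  have P: "P * (1 - fps_const q * fps_X) = fps_const (of_real t) * fps_X"
  proof -
    have u: "fps_nth (1 - fps_const q * fps_X) 0 \<noteq> 0" by simp
    show ?thesis
      unfolding P_def by (simp add: fps_divide_unit[OF u] mult.assoc inverse_mult_eq_1[OF u])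
  qed
  have ex: "?\<phi> has_fps_expansion P"
  proof -
    have "(\<lambda>z. of_real t * z / (1 - q * z)) has_fps_expansion P"
      unfolding P_def by (intro fps_expansion_intros) auto
    moreover have "eventually (\<lambda>z. of_real t * z / (1 - q * z) = ?\<phi> z) (nhds 0)"
      by (rule eventually_mono[OF eventually_nhds_in_open[of unit_disk 0]]) (simp_all only: \<phi>, auto)
    ultimately show ?thesis by (simp add: has_fps_expansion_cong)
  qed
  have q1: "cmod q = 1 - t" using t \<zeta> by (simp add: q_def norm_mult del: of_real_diff)
  have P0: "fps_nth (P ^ n) 0 = (if n = 0 then 1 else 0)" for n
  proof -
    have "fps_nth (P * (1 - fps_const q * fps_X)) 0 = 0" unfolding P by simp
    then have "fps_nth P 0 = 0" by simp
    then show ?thesis by simp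
  qed
  have main: "\<exists>G. (\<forall>z\<in>unit_disk. hardy_fun G z = (\<Sum>n<N. c n * ?\<phi> z ^ Suc n)) \<and>
                 norm G \<le> sqrt t * sqrt (\<Sum>n<N. (cmod (c n))\<^sup>2)" for c N
  proof -
    let ?f = "\<lambda>z. \<Sum>n<N. c n * ?\<phi> z ^ Suc n"
    have "?f has_fps_expansion (\<Sum>n<N. fps_const (c n) * P ^ Suc n)"
      by (intro fps_expansion_intros ex)
    then have co: "fps_nth (fps_expansion ?f 0) k = (\<Sum>n<N. c n * fps_nth (P ^ Suc n) k)" for k
      by (simp add: fps_expansion_eqI fps_sum_nth del: power_Suc)
    let ?B = "sqrt t * sqrt (\<Sum>n<N. (cmod (c n))\<^sup>2)"
    have bd: "(\<Sum>k<K. (cmod (fps_nth (fps_expansion ?f 0) k))\<^sup>2) \<le> ?B\<^sup>2" for K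
      using schur_bound[OF geometric_fps_bounds(1)[OF P q1 t] geometric_fps_bounds(2)[OF P q1 t], where c = c and K = K and N = N] t
      unfolding co by (simp add: power_mult_distrib sum_nonneg del: power_Suc)
    have hol: "?f holomorphic_on unit_disk"
      by (intro holomorphic_intros h)
    have "summable (\<lambda>k. (cmod (fps_nth (fps_expansion ?f 0) k))\<^sup>2)"
      by (rule summableI_nonneg_bounded[OF _ bd]) simp
    then obtain G where G: "\<And>z. z \<in> unit_disk \<Longrightarrow> hardy_fun G z = ?f z"
       "\<And>k. hardy_coeff G k = fps_nth (fps_expansion ?f 0) k"
      by (rule hardy_of_function[OF hol]) blast
    have "norm G \<le> ?B"
    proof (rule norm_hardy_leI)
      show "(\<Sum>k<K. (cmod (hardy_coeff G k))\<^sup>2) \<le> ?B\<^sup>2" for K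
        unfolding G(2) by (rule bd)
      show "0 \<le> ?B" using t by (simp add: sum_nonneg)
    qed
    with G(1) show ?thesis by blast
  qed
  \<comment> \<open>The constant term is split off; the row bound concerns the positive powers.\<close>
  have bd: "\<exists>G. (\<forall>z\<in>unit_disk. hardy_fun G z = (\<Sum>n<N. c n * ?\<phi> z ^ n)) \<and>
                norm G \<le> 2 * sqrt (\<Sum>n<N. (cmod (c n))\<^sup>2)" for c N
  proof (cases N)
    case 0
    then show ?thesis by (intro exI[of _ 0]) (simp add: hardy_fun_zero)
  next
    case (Suc N')
    obtain G where G: "\<forall>z\<in>unit_disk. hardy_fun G z = (\<Sum>n<N'. c (Suc n) * ?\<phi> z ^ Suc n)"
                 "norm G \<le> sqrt t * sqrt (\<Sum>n<N'. (cmod (c (Suc n)))\<^sup>2)"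
      using main[of "\<lambda>n. c (Suc n)" N'] by blast
    let ?S = "sqrt (\<Sum>n<N. (cmod (c n))\<^sup>2)"
    have N: "(\<Sum>n<N. (cmod (c n))\<^sup>2) = (cmod (c 0))\<^sup>2 + (\<Sum>n<N'. (cmod (c (Suc n)))\<^sup>2)"
      unfolding Suc by (rule sum.lessThan_Suc_shift)
    have "norm (hardy_scale (c 0) (hardy_monom 0)) \<le> cmod (c 0)"
      using norm_monom_le by (simp add: norm_hardy_scale mult_left_le)
    also have "\<dots> \<le> ?S"
      by (rule real_le_rsqrt) (simp add: N sum_nonneg)
    finally have 1: "norm (hardy_scale (c 0) (hardy_monom 0)) \<le> ?S" .
    have "norm G \<le> 1 * sqrt (\<Sum>n<N'. (cmod (c (Suc n)))\<^sup>2)"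
      using t by (intro order_trans[OF G(2)] mult_right_mono) (auto simp: sum_nonneg)
    also have "\<dots> \<le> ?S" unfolding N by simp
    finally have "norm (hardy_scale (c 0) (hardy_monom 0) + G) \<le> 2 * ?S"
      using 1 norm_triangle_ineq[of "hardy_scale (c 0) (hardy_monom 0)" G] by linarith
    moreover have "\<forall>z\<in>unit_disk. hardy_fun (hardy_scale (c 0) (hardy_monom 0) + G) z = (\<Sum>n<N. c n * ?\<phi> z ^ n)"
      unfolding Suc sum.lessThan_Suc_shift using G(1)
      by (simp add: hardy_fun_add hardy_fun_scale fun_monom)
    ultimately show ?thesis by blast
  qed
  obtain T where T: "is_composition_op ?\<phi> T"
    by (rule composition_op_exists[OF h _ bd]) simp
  have "norm (blinfun_apply T f) \<le> sqrt t * norm f" if f0: "hardy_coeff f 0 = 0" for f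
  proof (rule LIMSEQ_le_const2)
    show "(\<lambda>N. norm (blinfun_apply T (trunc (Suc N) f))) \<longlonglongrightarrow> norm (blinfun_apply T f)"
      by (intro tendsto_norm blinfun.tendsto tendsto_const LIMSEQ_Suc trunc_tendsto)
    have "norm (blinfun_apply T (trunc (Suc N) f)) \<le> sqrt t * norm f" for N
    proof -
      obtain G where G: "\<forall>z\<in>unit_disk. hardy_fun G z = (\<Sum>n<N. hardy_coeff f (Suc n) * ?\<phi> z ^ Suc n)"
                 "norm G \<le> sqrt t * sqrt (\<Sum>n<N. (cmod (hardy_coeff f (Suc n)))\<^sup>2)"
        using main[of "\<lambda>n. hardy_coeff f (Suc n)" N] by blast
      have "blinfun_apply T (trunc (Suc N) f) = G"
      proof (rule hardy_fun_eqI)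
        fix z assume z: "z \<in> unit_disk"
        then have "?\<phi> z \<in> unit_disk" using h(2) by blast
        then show "hardy_fun (blinfun_apply T (trunc (Suc N) f)) z = hardy_fun G z"
          using T z G(1) unfolding is_composition_op_def trunc_def sum.lessThan_Suc_shift
          by (simp add: hardy_fun_sum hardy_fun_add hardy_fun_scale fun_monom f0)
      qed
      moreover have "(\<Sum>n<N. (cmod (hardy_coeff f (Suc n)))\<^sup>2) \<le> (norm f)\<^sup>2"
        using sum_coeff_le_norm[of f "Suc N"] by (simp add: sum.lessThan_Suc_shift f0 del: sum.lessThan_Suc)
      then have "sqrt (\<Sum>n<N. (cmod (hardy_coeff f (Suc n)))\<^sup>2) \<le> norm f"
        by (rule real_le_lsqrt[rotated 1]) simp
      ultimately show ?thesis
        using G(2) t by (metis mult_left_mono order_trans real_sqrt_ge_zero less_imp_le)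
    qed
    then show "\<exists>N0. \<forall>N\<ge>N0. norm (blinfun_apply T (trunc (Suc N) f)) \<le> sqrt t * norm f" by blast
  qed
  with T show ?thesis by (rule that)
qed

lemma automorphism_op:
  fixes s :: real and \<zeta> :: complex
  assumes \<zeta>: "cmod \<zeta> = 1" and s: "0 < s"
  obtains T where "is_composition_op (hp_affine \<zeta> s (\<i> * of_real y)) T"
proof -
  let ?\<phi> = "hp_affine \<zeta> s (\<i> * of_real y)"
  define c where "c = (s - \<i> * y - 1) * cnj \<zeta>"
  define d where "d = s + \<i> * y + 1"
  have \<phi>: "?\<phi> z = (cnj d * z + cnj c) / (c * z + d)" for z
    by (simp add: hp_affine_def moebius_def c_def d_def)
  have "(cmod d)\<^sup>2 - (cmod c)\<^sup>2 = 4 * s"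
    unfolding c_def d_def norm_mult complex_mod_cnj \<zeta> mult_1_right cmod_power2
    by (simp add: power2_eq_square algebra_simps)
  then have "(cmod c)\<^sup>2 < (cmod d)\<^sup>2" using s by simp
  then have cd: "cmod c < cmod d" by (rule power2_less_imp_less) simp
  obtain U where U: "hardy_scale c (shift U) + hardy_scale d U = hardy_monom 0"
    using hardy_divide_affine[OF cd] .
  have bd: "\<exists>G. (\<forall>z\<in>unit_disk. hardy_fun G z = (\<Sum>n<N. a n * ?\<phi> z ^ n)) \<and>
                norm G \<le> (cmod c + cmod d) * norm U * sqrt (\<Sum>n<N. (cmod (a n))\<^sup>2)" for a N
  proof -
    obtain G where G: "\<forall>z\<in>unit_disk. (c * z + d) * hardy_fun G z = (\<Sum>n<N. a n * ?\<phi> z ^ n)"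
      "(norm G)\<^sup>2 = (norm U)\<^sup>2 * (\<Sum>n<N. (cmod (a n))\<^sup>2)"
      using automorphism_polynomial_norm[OF cd U, where N = N and a = a] unfolding \<phi> by blast
    have "norm G = norm U * sqrt (\<Sum>n<N. (cmod (a n))\<^sup>2)"
      using arg_cong[OF G(2), of sqrt] by (simp add: real_sqrt_mult)
    then show ?thesis
      using G(1) norm_affine_le[of c G d] fun_affine
      by (intro exI[of _ "hardy_scale c (shift G) + hardy_scale d G"]) (simp add: mult.assoc)
  qed
  have r: "Re (\<i> * of_real y) \<ge> 0" by simp
  show ?thesis
    by (rule composition_op_exists[OF hp_affine_holomorphic[OF \<zeta> s r] hp_affine_image[OF \<zeta> s r] _ bd])
      (use that in auto)
qed

text \<open>
  Composition of the two previous cases: \<open>w \<mapsto> t w + b\<close> is \<open>w \<mapsto> (t / s) w + (1 - t / s)\<close> followed by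
  \<open>w \<mapsto> s w + \<i> Im b\<close>, where \<open>s = t + Re b\<close>.
\<close>

lemma hp_affine_op:
  fixes t :: real and \<zeta> b :: complex
  assumes \<zeta>: "cmod \<zeta> = 1" and t: "0 < t" and b: "Re b \<ge> 0"
  obtains T where "is_composition_op (hp_affine \<zeta> t b) T"
proof -
  define s where "s = t + Re b"
  have s: "s > 0" "t / s \<le> 1" "0 < t / s" using t b by (auto simp: s_def)
  obtain S where S: "is_composition_op (hp_affine \<zeta> s (\<i> * of_real (Im b))) S"
    using automorphism_op[OF \<zeta> s(1)] .
  obtain R where R: "is_composition_op (hp_affine \<zeta> (t / s) (of_real (1 - t / s))) R"
    using contraction_op[OF \<zeta> s(3,2)] by blast
  have self: "hp_affine \<zeta> (t / s) (of_real (1 - t / s)) ` unit_disk \<subseteq> unit_disk"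
    by (rule hp_affine_image[OF \<zeta>]) (use s in auto)
  have "is_composition_op (hp_affine \<zeta> t b) (R o\<^sub>L S)"
  proof (rule composition_op_cong[OF composition_op_compose[OF R S self]])
    fix z assume z: "z \<in> unit_disk"
    have "hp_affine \<zeta> s (\<i> * of_real (Im b)) (hp_affine \<zeta> (t / s) (of_real (1 - t / s)) z) =
       hp_affine \<zeta> (s * (t / s)) (of_real s * of_real (1 - t / s) + \<i> * of_real (Im b)) z"
      by (rule hp_affine_compose[OF \<zeta>]) (use s z in auto)
    also have "s * (t / s) = t" using s by simp
    also have "of_real s * of_real (1 - t / s) + \<i> * of_real (Im b) = b"
    proof -
      have "s * (1 - t / s) = Re b" using s by (simp add: s_def field_simps)
      then have "of_real s * of_real (1 - t / s) = complex_of_real (Re b)"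
        by (metis of_real_mult)
      then show ?thesis
        by (simp only: complex_eq[of b, symmetric])
    qed
    finally show "(hp_affine \<zeta> s (\<i> * of_real (Im b)) \<circ> hp_affine \<zeta> (t / s) (of_real (1 - t / s))) z = hp_affine \<zeta> t b z"
      by simp
  qed
  then show ?thesis by (rule that)
qed

section \<open>Rank-one operators\<close>

lemma hardy_inner_cauchy_schwarz: "cmod (hardy_inner f g) \<le> norm f * norm g"
proof (cases "hardy_inner f g = 0")
  case False
  let ?c = "hardy_inner f g"
  have "(cmod ?c)\<^sup>2 = inner (hardy_scale (cnj ?c) f) g"
    unfolding inner_hardy_def hardy_inner_scale_left
    by (metis Re_complex_of_real complex_norm_square mult.commute of_real_power)
  also have "\<dots> \<le> norm (hardy_scale (cnj ?c) f) * norm g"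
    by (rule norm_cauchy_schwarz)
  finally have "cmod ?c * cmod ?c \<le> cmod ?c * (norm f * norm g)"
    by (simp add: norm_hardy_scale power2_eq_square mult.assoc)
  then show ?thesis using False by (simp add: mult_le_cancel_left)
qed simp

lemma hardy_inner_add_right: "hardy_inner f (g + h) = hardy_inner f g + hardy_inner f h"
  by (metis hardy_inner_add_left hardy_inner_commute complex_cnj_add)

lemma hardy_inner_diff_right: "hardy_inner f (g - h) = hardy_inner f g - hardy_inner f h"
  using hardy_inner_add_right[of f "g - h" h] by simp

lemma hardy_inner_extensional:
  assumes "\<And>f. hardy_inner f x = hardy_inner f y"
  shows "x = y"
proof (rule hardy_eqI)
  show "hardy_coeff x n = hardy_coeff y n" for n
    using assms[of "hardy_monom n"] by (simp add: inner_monom_left)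
qed

lemma bounded_linear_hardy_coeff: "bounded_linear (\<lambda>f. hardy_coeff f n)"
proof (rule bounded_linear_intro)
  show "cmod (hardy_coeff f n) \<le> norm f * 1" for f using coeff_le_norm by simp
qed (simp_all add: hardy_coeff_add scaleR_hardy_eq hardy_coeff_scale scaleR_conv_of_real)

definition rank_one :: "hardy \<Rightarrow> hardy \<Rightarrow> hardy \<Rightarrow>\<^sub>L hardy" where
  "rank_one u v = Blinfun (\<lambda>f. hardy_scale (hardy_inner f v) u)"

lemma rank_one_apply: "blinfun_apply (rank_one u v) f = hardy_scale (hardy_inner f v) u"
  unfolding rank_one_def
proof (rule bounded_linear_Blinfun_apply[THEN fun_cong], rule bounded_linear_intro)
  show "hardy_scale (hardy_inner (f + g) v) u = hardy_scale (hardy_inner f v) u + hardy_scale (hardy_inner g v) u" for f g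
    by (simp add: hardy_inner_add_left hardy_scale_add_left)
  show "hardy_scale (hardy_inner (r *\<^sub>R f) v) u = r *\<^sub>R hardy_scale (hardy_inner f v) u" for r f
    by (simp add: scaleR_hardy_eq hardy_inner_scale_left hardy_scale_scale)
  show "norm (hardy_scale (hardy_inner f v) u) \<le> norm f * (norm v * norm u)" for f
    using mult_right_mono[OF hardy_inner_cauchy_schwarz[of f v], of "norm u"]
    by (simp add: norm_hardy_scale mult.assoc)
qed

lemma norm_rank_one_le: "norm (rank_one u v) \<le> norm u * norm v"
proof (rule norm_blinfun_bound)
  show "norm (blinfun_apply (rank_one u v) f) \<le> norm u * norm v * norm f" for f
    using mult_right_mono[OF hardy_inner_cauchy_schwarz[of f v], of "norm u"]
    by (simp add: rank_one_apply norm_hardy_scale mult_ac)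
qed simp

lemma rank_one_diff_left: "rank_one (u - w) v = rank_one u v - rank_one w v"
  by (rule blinfun_eqI) (simp add: rank_one_apply hardy_scale_diff blinfun.diff_left)

lemma rank_one_diff_right: "rank_one u (v - w) = rank_one u v - rank_one u w"
  by (rule blinfun_eqI) (simp add: rank_one_apply hardy_inner_diff_right hardy_scale_diff_left blinfun.diff_left)

lemma rank_one_scale_left: "rank_one (hardy_scale c u) v = op_scale c (rank_one u v)"
  by (rule blinfun_eqI) (simp add: rank_one_apply op_scale_apply hardy_scale_scale mult.commute)

lemma rank_one_scale_right: "rank_one u (hardy_scale c v) = op_scale (cnj c) (rank_one u v)"
  by (rule blinfun_eqI) (simp add: rank_one_apply op_scale_apply hardy_scale_scale hardy_inner_scale_right)

lemma rank_one_add_left: "rank_one (u + w) v = rank_one u v + rank_one w v"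
  by (rule blinfun_eqI) (simp add: rank_one_apply hardy_scale_add blinfun.add_left)

lemma rank_one_add_right: "rank_one u (v + w) = rank_one u v + rank_one u w"
  by (rule blinfun_eqI) (simp add: rank_one_apply hardy_inner_add_right hardy_scale_add_left blinfun.add_left)

lemma tendsto_rank_one_left:
  assumes "(\<lambda>n. u n) \<longlonglongrightarrow> u'"
  shows "(\<lambda>n. rank_one (u n) v) \<longlonglongrightarrow> rank_one u' v"
proof (rule LIM_zero_cancel, rule Lim_null_comparison)
  show "\<forall>\<^sub>F n in sequentially. norm (rank_one (u n) v - rank_one u' v) \<le> norm (u n - u') * norm v"
    using norm_rank_one_le by (simp add: rank_one_diff_left[symmetric])
  show "(\<lambda>n. norm (u n - u') * norm v) \<longlonglongrightarrow> 0"
    by (intro tendsto_mult_left_zero tendsto_norm_zero LIM_zero assms)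
qed

lemma tendsto_rank_one_right:
  assumes "(\<lambda>n. v n) \<longlonglongrightarrow> v'"
  shows "(\<lambda>n. rank_one u (v n)) \<longlonglongrightarrow> rank_one u v'"
proof (rule LIM_zero_cancel, rule Lim_null_comparison)
  show "\<forall>\<^sub>F n in sequentially. norm (rank_one u (v n) - rank_one u v') \<le> norm u * norm (v n - v')"
    using norm_rank_one_le by (simp add: rank_one_diff_right[symmetric])
  show "(\<lambda>n. norm u * norm (v n - v')) \<longlonglongrightarrow> 0"
    by (intro tendsto_mult_right_zero tendsto_norm_zero LIM_zero assms)
qed

lemma compose_rank_one:
  assumes "S \<in> hardy_ops"
  shows "S o\<^sub>L rank_one u v = rank_one (blinfun_apply S u) v"
  using assms by (intro blinfun_eqI) (simp add: rank_one_apply hardy_ops_def)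

lemma rank_one_compose_rank_one:
  "rank_one u v o\<^sub>L rank_one u' v' = op_scale (hardy_inner u' v) (rank_one u v')"
  by (rule blinfun_eqI)
     (simp add: rank_one_apply op_scale_apply hardy_inner_scale_left hardy_scale_scale mult.commute)

lemma adjoint_rank_one:
  assumes "is_adjoint (rank_one u v) S"
  shows "S = rank_one v u"
proof (rule blinfun_eqI, rule hardy_inner_extensional)
  fix f g
  have "hardy_inner f (blinfun_apply S g) = hardy_inner (blinfun_apply (rank_one u v) f) g"
    using assms by (simp add: is_adjoint_def)
  also have "\<dots> = hardy_inner f (blinfun_apply (rank_one v u) g)"
    by (simp add: rank_one_apply hardy_inner_scale_left hardy_inner_scale_right
          hardy_inner_commute[of u g, symmetric])
  finally show "hardy_inner f (blinfun_apply S g) = hardy_inner f (blinfun_apply (rank_one v u) g)" .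
qed

section \<open>Compact operators in a C*-algebra\<close>

context
  fixes A
  assumes A: "unital_cstar_algebra A"
begin

lemma cstar_hardy_ops: "T \<in> A \<Longrightarrow> T \<in> hardy_ops"
  and cstar_closed: "closed A"
  and cstar_add: "S \<in> A \<Longrightarrow> T \<in> A \<Longrightarrow> S + T \<in> A"
  and cstar_scale: "T \<in> A \<Longrightarrow> op_scale c T \<in> A"
  and cstar_compose: "S \<in> A \<Longrightarrow> T \<in> A \<Longrightarrow> S o\<^sub>L T \<in> A"
  using A unfolding unital_cstar_algebra_def by auto

lemma cstar_adjoint: "T \<in> A \<Longrightarrow> \<exists>S\<in>A. is_adjoint T S"
  using A unfolding unital_cstar_algebra_def by blast

lemma cstar_zero: "0 \<in> A"
proof -
  have "op_scale 0 id_blinfun = 0"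
    by (rule blinfun_eqI) (simp add: op_scale_apply)
  moreover have "id_blinfun \<in> A" using A by (simp add: unital_cstar_algebra_def)
  ultimately show ?thesis using cstar_scale by metis
qed

lemma cstar_sum: "(\<And>i. i \<in> I \<Longrightarrow> T i \<in> A) \<Longrightarrow> (\<Sum>i\<in>I. T i) \<in> A"
  by (induction I rule: infinite_finite_induct) (auto simp: cstar_zero cstar_add)

lemma cstar_limit: "(\<And>n. T n \<in> A) \<Longrightarrow> T \<longlonglongrightarrow> S \<Longrightarrow> S \<in> A"
  using cstar_closed closed_sequentially by blast

lemma cstar_rank_one_sum_left:
  "(\<And>i. i \<in> I \<Longrightarrow> rank_one (u i) v \<in> A) \<Longrightarrow> rank_one (\<Sum>i\<in>I. u i) v \<in> A"
proof (induction I rule: infinite_finite_induct)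
  case (insert i I)
  then show ?case by (simp add: rank_one_add_left cstar_add)
qed (use rank_one_diff_left[of 0 0 v] cstar_zero in simp_all)

lemma cstar_rank_one_sum_right:
  "(\<And>i. i \<in> I \<Longrightarrow> rank_one u (v i) \<in> A) \<Longrightarrow> rank_one u (\<Sum>i\<in>I. v i) \<in> A"
proof (induction I rule: infinite_finite_induct)
  case (insert i I)
  then show ?case by (simp add: rank_one_add_right cstar_add)
qed (use rank_one_diff_right[of u 0 0] cstar_zero in simp_all)

lemma cstar_rank_one_scale:
  "rank_one u v \<in> A \<Longrightarrow> rank_one (hardy_scale c u) v \<in> A"
  "rank_one u v \<in> A \<Longrightarrow> rank_one u (hardy_scale c v) \<in> A"
  by (simp_all add: rank_one_scale_left rank_one_scale_right cstar_scale)

lemma cstar_rank_one_diff: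
  assumes "rank_one u v \<in> A" "rank_one w v \<in> A"
  shows "rank_one (u - w) v \<in> A"
proof -
  have "u - w = u + hardy_scale (-1) w"
    by (rule hardy_eqI) (simp add: hardy_coeff_diff hardy_coeff_add hardy_coeff_scale)
  then show ?thesis
    using assms by (simp only: rank_one_add_left cstar_add cstar_rank_one_scale)
qed

end

text \<open>
  The representing vector is written down by its coefficients, the conjugates of the values on monomials;
  testing the functional on its truncations shows that they are square-summable.
\<close>

lemma hardy_riesz:
  assumes "T \<in> hardy_ops"
  obtains g where "\<And>f. hardy_coeff (blinfun_apply T f) n = hardy_inner f g"
proof -
  let ?ev = "\<lambda>f. hardy_coeff (blinfun_apply T f) n"
  interpret L: bounded_linear ?ev
    by (intro bounded_linear_compose[OF bounded_linear_hardy_coeff] blinfun.bounded_linear_right)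
  define l where "l m = ?ev (hardy_monom m)" for m
  have comb: "?ev (\<Sum>m<M. hardy_scale (c m) (hardy_monom m)) = (\<Sum>m<M. c m * l m)" for c M
    using assms by (simp add: L.sum hardy_ops_def hardy_coeff_scale l_def)
  have bd: "(\<Sum>m<M. (cmod (l m))\<^sup>2) \<le> (norm T)\<^sup>2" for M
  proof -
    define s where "s = (\<Sum>m<M. (cmod (l m))\<^sup>2)"
    define f where "f = (\<Sum>m<M. hardy_scale (cnj (l m)) (hardy_monom m))"
    have s: "s \<ge> 0" by (simp add: s_def sum_nonneg)
    have co: "hardy_coeff f k = (if k < M then cnj (l k) else 0)" for k
    proof -
      have "hardy_coeff f k = (\<Sum>m<M. if m = k then cnj (l k) else 0)"
        unfolding f_def hardy_coeff_sum
        by (intro sum.cong) (auto simp: hardy_coeff_scale coeff_monom)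
      then show ?thesis by simp
    qed
    have nf: "norm f \<le> sqrt s"
    proof (rule norm_hardy_leI)
      fix K
      have "(\<Sum>k<K. (cmod (hardy_coeff f k))\<^sup>2) = (\<Sum>k\<in>{..<K} \<inter> {..<M}. (cmod (l k))\<^sup>2)"
        by (rule sum.mono_neutral_cong_right) (auto simp: co)
      also have "\<dots> \<le> s" unfolding s_def by (rule sum_mono2) auto
      finally show "(\<Sum>k<K. (cmod (hardy_coeff f k))\<^sup>2) \<le> (sqrt s)\<^sup>2" using s by simp
    qed (simp add: s)
    have "?ev f = of_real s"
      unfolding f_def comb s_def of_real_sum complex_norm_square by (simp add: mult.commute)
    then have "s = cmod (?ev f)" using s by simp
    also have "\<dots> \<le> norm (blinfun_apply T f)" by (rule coeff_le_norm)
    also have "\<dots> \<le> norm T * norm f" by (rule norm_blinfun)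
    also have "\<dots> \<le> norm T * sqrt s" using nf by (simp add: mult_left_mono)
    finally have "sqrt s * sqrt s \<le> norm T * sqrt s" using s by simp
    then have "sqrt s \<le> norm T"
      using s by (cases "s = 0") (auto intro: mult_right_le_imp_le simp del: real_sqrt_mult_self)
    then show ?thesis unfolding s_def[symmetric]
      using power_mono[of "sqrt s" "norm T" 2] s by simp
  qed
  have "summable (\<lambda>m. (cmod (cnj (l m)))\<^sup>2)"
    by (rule summableI_nonneg_bounded[where x = "(norm T)\<^sup>2"]) (use bd in auto)
  then obtain g where g: "\<And>m. hardy_coeff g m = cnj (l m)"
    by (rule hardy_of_coeffs) blast
  show ?thesis
  proof (rule that)
    fix f
    have "(\<lambda>N. ?ev (trunc N f)) \<longlonglongrightarrow> ?ev f"
      by (intro L.tendsto trunc_tendsto)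
    moreover have "(\<lambda>N. ?ev (trunc N f)) \<longlonglongrightarrow> hardy_inner f g"
      using summable_LIMSEQ[OF summable_hardy_inner[of f g]]
      unfolding trunc_def comb hardy_inner_def by (simp add: g)
    ultimately show "?ev f = hardy_inner f g" by (rule LIMSEQ_unique)
  qed
qed

lemma trunc_diff: "trunc N (f - g) = trunc N f - trunc N g"
  by (rule hardy_eqI) (simp add: coeff_trunc hardy_coeff_diff)

lemma compact_trunc_uniform:
  assumes "compact K" "e > 0"
  obtains N where "\<And>y. y \<in> K \<Longrightarrow> norm (y - trunc N y) < e"
proof -
  have "\<exists>X. finite X \<and> X \<subseteq> K \<and> K \<subseteq> (\<Union>x\<in>X. ball x (e/3))"
    using compactE_image[OF assms(1), of K "\<lambda>x. ball x (e/3)"] assms(2)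
    by (metis UN_I centre_in_ball divide_pos_pos open_ball subsetI zero_less_numeral)
  then obtain X where X: "finite X" "K \<subseteq> (\<Union>x\<in>X. ball x (e/3))" by blast
  have "\<forall>\<^sub>F N in sequentially. \<forall>x\<in>X. dist (trunc N x) x < e/3"
    using X(1) tendstoD[OF trunc_tendsto, of "e/3"] assms(2) by (intro eventually_ball_finite) auto
  then obtain N where N: "\<And>x. x \<in> X \<Longrightarrow> dist (trunc N x) x < e/3"
    by (auto simp: eventually_sequentially)
  show ?thesis
  proof (rule that)
    fix y assume "y \<in> K"
    then obtain x where x: "x \<in> X" "dist x y < e/3" using X(2) by auto
    have "norm (y - trunc N y) = norm ((y - x) + (x - trunc N x) + trunc N (x - y))"
      by (simp add: trunc_diff)
    also have "\<dots> \<le> norm (y - x) + norm (x - trunc N x) + norm (trunc N (x - y))"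
      by (meson norm_triangle_ineq norm_triangle_mono order_refl)
    also have "norm (trunc N (x - y)) \<le> norm (x - y)" by (rule trunc_norm_le)
    finally show "norm (y - trunc N y) < e"
      using x(2) N[OF x(1)] by (simp add: dist_norm norm_minus_commute)
  qed
qed

lemma compact_ops_approximable:
  assumes T: "T \<in> compact_ops" and "e > 0"
  obtains N where "\<And>f. norm (blinfun_apply T f - trunc N (blinfun_apply T f)) \<le> e * norm f"
proof -
  have "compact (closure (blinfun_apply T ` cball 0 1))"
    using T by (simp add: compact_ops_def)
  then obtain N where N: "\<And>y. y \<in> closure (blinfun_apply T ` cball 0 1) \<Longrightarrow> norm (y - trunc N y) < e"
    using compact_trunc_uniform \<open>e > 0\<close> by blast
  show ?thesis
  proof (rule that)
    fix f
    show "norm (blinfun_apply T f - trunc N (blinfun_apply T f)) \<le> e * norm f"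
    proof (cases "f = 0")
      case True
      have "trunc N 0 = 0" using trunc_diff[of N 0 0] by simp
      then show ?thesis using True by simp
    next
      case False
      define g where "g = f /\<^sub>R norm f"
      have "blinfun_apply T g \<in> closure (blinfun_apply T ` cball 0 1)"
        using False by (intro subsetD[OF closure_subset] imageI) (simp add: g_def)
      from N[OF this] have 1: "norm (blinfun_apply T g - trunc N (blinfun_apply T g)) \<le> e" by simp
      have f: "f = norm f *\<^sub>R g" using False by (simp add: g_def)
      have tr: "trunc N (r *\<^sub>R h) = r *\<^sub>R trunc N h" for r h
        by (rule hardy_eqI) (simp add: coeff_trunc scaleR_hardy_eq hardy_coeff_scale)
      have "blinfun_apply T f - trunc N (blinfun_apply T f) =
            norm f *\<^sub>R (blinfun_apply T g - trunc N (blinfun_apply T g))"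
        by (subst (1 2) f) (simp add: blinfun.scaleR_right tr scaleR_diff_right)
      then show ?thesis
        using mult_left_mono[OF 1, of "norm f"] by (simp add: mult.commute)
    qed
  qed
qed

text \<open>
  The truncation \<open>trunc N \<circ> T\<close> is a finite sum of operators \<open>rank_one (hardy_monom n) g\<close> by Riesz
  representation of the coefficients of \<open>T\<close>, and truncations converge uniformly on the compact closure of
  the image of the unit ball.
\<close>

lemma compact_in_cstar:
  assumes A: "unital_cstar_algebra A"
    and mon: "\<And>m n. rank_one (hardy_monom m) (hardy_monom n) \<in> A"
  shows "compact_ops \<subseteq> A"
proof
  fix T assume T: "T \<in> compact_ops"
  then have Th: "T \<in> hardy_ops" by (simp add: compact_ops_def)
  have r: "rank_one (hardy_monom n) g \<in> A" for n g
  proof (rule cstar_limit[OF A])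
    show "rank_one (hardy_monom n) (trunc N g) \<in> A" for N
      unfolding trunc_def
      by (intro cstar_rank_one_sum_right[OF A] cstar_rank_one_scale[OF A] mon)
    show "(\<lambda>N. rank_one (hardy_monom n) (trunc N g)) \<longlonglongrightarrow> rank_one (hardy_monom n) g"
      by (intro tendsto_rank_one_right trunc_tendsto)
  qed
  have "\<forall>n. \<exists>g. \<forall>f. hardy_coeff (blinfun_apply T f) n = hardy_inner f g"
    using hardy_riesz[OF Th] by metis
  then obtain g where g: "\<And>n f. hardy_coeff (blinfun_apply T f) n = hardy_inner f (g n)"
    by metis
  have "\<exists>S\<in>A. dist S T < e" if "e > 0" for e
  proof -
    obtain N where N: "\<And>f. norm (blinfun_apply T f - trunc N (blinfun_apply T f)) \<le> (e/2) * norm f"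
      using compact_ops_approximable[OF T, of "e/2"] \<open>e > 0\<close> by auto
    define S where "S = (\<Sum>n<N. rank_one (hardy_monom n) (g n))"
    have S: "blinfun_apply S f = trunc N (blinfun_apply T f)" for f
      unfolding S_def trunc_def by (simp add: blinfun.sum_left rank_one_apply g)
    have "norm (T - S) \<le> e/2"
      using N \<open>e > 0\<close> by (intro norm_blinfun_bound) (simp_all add: blinfun.diff_left S)
    then have "dist S T < e" using \<open>e > 0\<close> by (simp add: dist_norm norm_minus_commute)
    moreover have "S \<in> A" unfolding S_def by (intro cstar_sum[OF A] r)
    ultimately show ?thesis by blast
  qed
  then show "T \<in> A" using closed_approachable[OF cstar_closed[OF A], of T] by blast
qed

section \<open>The compact operators generated by composition operators\<close>

lemma coeff_shift_funpow:
  "hardy_coeff ((shift ^^ m) f) k = (if k < m then 0 else hardy_coeff f (k - m))"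
proof (induction m arbitrary: k)
  case (Suc m)
  then show ?case by (cases k) (simp_all add: coeff_shift)
qed simp

lemma norm_shift_funpow: "norm ((shift ^^ m) f) = norm f"
  by (induction m) (simp_all add: norm_shift)

lemma F_ops_hp_affine:
  assumes "cmod \<zeta> = 1" "t > 0" "Re b > 0" "is_composition_op (hp_affine \<zeta> t b) T"
  shows "T \<in> F_ops \<zeta>"
  using hp_affine_nonauto[OF assms(1-3)] hp_affine_fixes[OF assms(1,2)] assms(4) unfolding F_ops_def by blast

lemma evaluation_at_0_in_cstar:
  assumes A: "unital_cstar_algebra A" and \<zeta>: "cmod \<zeta> = 1" and F: "F_ops \<zeta> \<subseteq> A"
  shows "rank_one (hardy_monom 0) (hardy_monom 0) \<in> A"
proof -
  define t where "t k = inverse (real (Suc (Suc k)))" for k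
  have t: "0 < t k" "t k < 1" for k by (auto simp: t_def field_simps)
  let ?\<phi> = "\<lambda>k. hp_affine \<zeta> (t k) (of_real (1 - t k))"
  have "\<forall>k. \<exists>T. is_composition_op (?\<phi> k) T \<and>
      (\<forall>f. hardy_coeff f 0 = 0 \<longrightarrow> norm (blinfun_apply T f) \<le> sqrt (t k) * norm f)"
    using contraction_op[OF \<zeta>] t by (metis less_imp_le)
  then obtain T where T: "\<And>k. is_composition_op (?\<phi> k) (T k)"
    and n: "\<And>k f. hardy_coeff f 0 = 0 \<Longrightarrow> norm (blinfun_apply (T k) f) \<le> sqrt (t k) * norm f"
    by metis
  have TA: "T k \<in> A" for k
    using F F_ops_hp_affine[OF \<zeta> t(1) _ T, of k] t(2)[of k] by auto
  have T1: "blinfun_apply (T k) (hardy_monom 0) = hardy_monom 0" for k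
  proof (rule hardy_fun_eqI)
    fix z assume z: "z \<in> unit_disk"
    have "?\<phi> k z \<in> unit_disk"
      by (rule hp_affine_in_disk[OF \<zeta> t(1) _ z]) (use t(2)[of k] in simp)
    then show "hardy_fun (blinfun_apply (T k) (hardy_monom 0)) z = hardy_fun (hardy_monom 0) z"
      using composition_op_monom[OF T[of k] z, of 0] fun_monom[OF z, of 0] by simp
  qed
  have Th: "T k \<in> hardy_ops" for k using cstar_hardy_ops[OF A TA] .
  let ?E = "rank_one (hardy_monom 0) (hardy_monom 0)"
  have bd: "norm (T k - ?E) \<le> sqrt (t k) * 2" for k
  proof (rule norm_blinfun_bound)
    show "0 \<le> sqrt (t k) * 2" using t(1)[of k] by simp
    fix f
    let ?c = "hardy_scale (hardy_coeff f 0) (hardy_monom 0)"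
    have "blinfun_apply (T k - ?E) f = blinfun_apply (T k) f - blinfun_apply (T k) ?c"
      using Th[of k] by (simp add: blinfun.diff_left rank_one_apply inner_monom_right T1 hardy_ops_def)
    also have "\<dots> = blinfun_apply (T k) (f - ?c)" by (simp add: blinfun.diff_right)
    also have "norm \<dots> \<le> sqrt (t k) * norm (f - ?c)"
      by (rule n) (simp add: hardy_coeff_diff hardy_coeff_scale coeff_monom)
    also have "norm ?c \<le> norm f"
      using mult_mono[OF coeff_le_norm[of f 0] norm_monom_le[of 0]] by (simp add: norm_hardy_scale)
    then have "norm (f - ?c) \<le> 2 * norm f"
      using norm_triangle_ineq4[of f ?c] by linarith
    then have "sqrt (t k) * norm (f - ?c) \<le> sqrt (t k) * (2 * norm f)"
      using t(1)[of k] by (intro mult_left_mono) auto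
    finally show "norm (blinfun_apply (T k - ?E) f) \<le> sqrt (t k) * 2 * norm f" by simp
  qed
  have "(\<lambda>k. sqrt (t k) * 2) \<longlonglongrightarrow> sqrt 0 * 2"
    unfolding t_def by (intro tendsto_mult tendsto_const tendsto_real_sqrt LIMSEQ_Suc[OF LIMSEQ_inverse_real_of_nat])
  then have "(\<lambda>k. T k - ?E) \<longlonglongrightarrow> 0"
    by (intro Lim_null_comparison[OF always_eventually[OF allI[OF bd]]]) simp
  then have "T \<longlonglongrightarrow> ?E" by (rule LIM_zero_cancel)
  then show ?thesis by (rule cstar_limit[OF A TA])
qed

text \<open>
  The function \<open>v\<close> is the reproducing kernel at \<open>\<zeta> x\<close>. It equals \<open>S 1\<close> for the adjoint \<open>S\<close> of a
  composition operator whose symbol sends the origin to \<open>\<zeta> x\<close>.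
\<close>

lemma kernel_in_cstar:
  fixes x :: real
  assumes A: "unital_cstar_algebra A" and \<zeta>: "cmod \<zeta> = 1" and F: "F_ops \<zeta> \<subseteq> A"
    and x: "0 < x" "x < 1"
  obtains v where "\<And>n. hardy_coeff v n = cnj (\<zeta> * x) ^ n" "rank_one v (hardy_monom 0) \<in> A"
proof -
  \<comment> \<open>Since \<open>z = 0\<close> is \<open>w = 1\<close>, the map \<open>w \<mapsto> t w + t\<close> sends it to \<open>w = 2 t\<close>, which is to be \<open>(1 + x) / (1 - x)\<close>.\<close>
  define t where "t = (1 + x) / (1 - x) / 2"
  have t: "t > 0" using x by (simp add: t_def)
  obtain T where T: "is_composition_op (hp_affine \<zeta> t t) T"
    using hp_affine_op[OF \<zeta> t, of "of_real t"] t by auto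
  have TA: "T \<in> A" using F F_ops_hp_affine[OF \<zeta> t _ T] t by auto
  have p: "hp_affine \<zeta> t t 0 = \<zeta> * x"
  proof -
    have "hp_affine \<zeta> t t 0 = of_real ((2 * t - 1) / (2 * t + 1)) * \<zeta>"
      by (simp add: hp_affine_def moebius_def)
    also have "(2 * t - 1) / (2 * t + 1) = x"
      using x by (simp add: t_def field_simps)
    finally show ?thesis by simp
  qed
  have px: "\<zeta> * x \<in> unit_disk" using x \<zeta> by (simp add: norm_mult)
  obtain S where S: "S \<in> A" "is_adjoint T S" using cstar_adjoint[OF A TA] by blast
  show ?thesis
  proof (rule that)
    show "hardy_coeff (blinfun_apply S (hardy_monom 0)) n = cnj (\<zeta> * x) ^ n" for n
    proof -
      have "cnj (hardy_coeff (blinfun_apply S (hardy_monom 0)) n) = hardy_inner (blinfun_apply T (hardy_monom n)) (hardy_monom 0)"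
        using S(2) by (simp add: is_adjoint_def inner_monom_left)
      also have "\<dots> = hardy_fun (blinfun_apply T (hardy_monom n)) 0"
        by (simp add: inner_monom_right hardy_fun_0)
      also have "\<dots> = (\<zeta> * x) ^ n"
        using composition_op_monom[OF T, of 0 n] px by (simp add: p)
      finally show ?thesis by (metis complex_cnj_cnj complex_cnj_power)
    qed
    show "rank_one (blinfun_apply S (hardy_monom 0)) (hardy_monom 0) \<in> A"
      using cstar_compose[OF A S(1) evaluation_at_0_in_cstar[OF A \<zeta> F]]
      by (simp add: compose_rank_one[OF cstar_hardy_ops[OF A S(1)]])
  qed
qed

text \<open>
  The kernels are \<open>v = (\<Sum>j. w\<^sup>j z\<^sup>j)\<close> with \<open>w = x cnj \<zeta>\<close>. Once the monomials below \<open>n\<close> are available, they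
  can be subtracted from \<open>v\<close>; after division by \<open>w\<^sup>n\<close> the remainder is \<open>z\<^sup>n + w z\<^sup>n\<^sup>+\<^sup>1 v\<close>, which tends to
  \<open>z\<^sup>n\<close> as \<open>x\<close> tends to 0.
\<close>

lemma monom_rank_one_in_cstar:
  assumes A: "unital_cstar_algebra A" and \<zeta>: "cmod \<zeta> = 1" and F: "F_ops \<zeta> \<subseteq> A"
  shows "rank_one (hardy_monom n) (hardy_monom 0) \<in> A"
proof (induction n rule: less_induct)
  case (less n)
  define x where "x k = inverse (real (Suc (Suc k)))" for k
  have x: "0 < x k" "x k < 1" "x k \<le> 1/2" for k by (auto simp: x_def field_simps)
  define w where "w k = cnj (\<zeta> * x k)" for k
  have wx: "cmod (w k) = x k" for k using \<zeta> x(1)[of k] by (simp add: w_def norm_mult)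
  have w0: "w k \<noteq> 0" for k using wx[of k] x(1)[of k] by auto
  have "\<forall>k. \<exists>v. (\<forall>j. hardy_coeff v j = w k ^ j) \<and> rank_one v (hardy_monom 0) \<in> A"
    using kernel_in_cstar[OF A \<zeta> F x(1,2)] unfolding w_def by metis
  then obtain v where v: "\<And>k j. hardy_coeff (v k) j = w k ^ j" "\<And>k. rank_one (v k) (hardy_monom 0) \<in> A"
    by metis
  define u where "u k = hardy_scale (1 / w k ^ n) (v k - (\<Sum>m<n. hardy_scale (w k ^ m) (hardy_monom m)))" for k
  have uA: "rank_one (u k) (hardy_monom 0) \<in> A" for k
    unfolding u_def
    by (intro cstar_rank_one_scale[OF A] cstar_rank_one_diff[OF A] cstar_rank_one_sum_left[OF A] v less) auto
  have eq: "u k - hardy_monom n = hardy_scale (w k) ((shift ^^ Suc n) (v k))" for k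
  proof (rule hardy_eqI)
    fix j
    have "hardy_coeff (\<Sum>m<n. hardy_scale (w k ^ m) (hardy_monom m)) j = (\<Sum>m<n. if m = j then w k ^ j else 0)"
      unfolding hardy_coeff_sum by (intro sum.cong) (auto simp: hardy_coeff_scale coeff_monom)
    then have "hardy_coeff (\<Sum>m<n. hardy_scale (w k ^ m) (hardy_monom m)) j = (if j < n then w k ^ j else 0)"
      by simp
    moreover have "w k ^ j / w k ^ n = w k * w k ^ (j - Suc n)" if "n < j"
      using that w0[of k] by (metis Suc_diff_Suc less_imp_le power_Suc power_diff)
    ultimately show "hardy_coeff (u k - hardy_monom n) j = hardy_coeff (hardy_scale (w k) ((shift ^^ Suc n) (v k))) j"
      using w0[of k]
      by (auto simp: u_def hardy_coeff_diff hardy_coeff_scale coeff_monom v coeff_shift_funpow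
               simp del: funpow.simps)
  qed
  have nv: "norm (v k) \<le> 2" for k
  proof -
    have "v k = hardy_monom 0 + hardy_scale (w k) (shift (v k))"
    proof (rule hardy_eqI)
      show "hardy_coeff (v k) j = hardy_coeff (hardy_monom 0 + hardy_scale (w k) (shift (v k))) j" for j
        by (cases j) (simp_all add: hardy_coeff_add hardy_coeff_scale coeff_monom coeff_shift v)
    qed
    then have "norm (v k) \<le> norm (hardy_monom 0) + x k * norm (v k)"
      by (metis norm_triangle_ineq norm_hardy_scale norm_shift wx)
    also have "\<dots> \<le> 1 + (1/2) * norm (v k)"
      using x(3)[of k] by (intro add_mono norm_monom_le mult_right_mono) auto
    finally show ?thesis by simp
  qed
  have "(\<lambda>k. u k - hardy_monom n) \<longlonglongrightarrow> 0"
  proof (rule Lim_null_comparison)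
    show "\<forall>\<^sub>F k in sequentially. norm (u k - hardy_monom n) \<le> x k * 2"
      unfolding eq norm_hardy_scale norm_shift_funpow wx
      using nv x(1) by (intro always_eventually allI mult_left_mono) (auto intro: less_imp_le)
    have "(\<lambda>k. x k * 2) \<longlonglongrightarrow> 0 * 2"
      unfolding x_def by (intro tendsto_mult tendsto_const LIMSEQ_Suc[OF LIMSEQ_inverse_real_of_nat])
    then show "(\<lambda>k. x k * 2) \<longlonglongrightarrow> 0" by simp
  qed
  then have "u \<longlonglongrightarrow> hardy_monom n" by (rule LIM_zero_cancel)
  from cstar_limit[OF A uA tendsto_rank_one_left[OF this]] show ?case .
qed

lemma compact_ops_subset_cstar:
  assumes A: "unital_cstar_algebra A" and \<zeta>: "cmod \<zeta> = 1" and F: "F_ops \<zeta> \<subseteq> A"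
  shows "compact_ops \<subseteq> A"
proof (rule compact_in_cstar[OF A])
  fix m n
  have "rank_one (hardy_monom 0) (hardy_monom n) \<in> A"
    using cstar_adjoint[OF A monom_rank_one_in_cstar[OF A \<zeta> F]] adjoint_rank_one by blast
  from cstar_compose[OF A monom_rank_one_in_cstar[OF A \<zeta> F] this]
  show "rank_one (hardy_monom m) (hardy_monom n) \<in> A"
    by (simp add: rank_one_compose_rank_one inner_monom_right coeff_monom rank_one_scale_left[symmetric])
qed

section \<open>Parabolic maps\<close>

lemma parabolic_map_hp_affine: "parabolic_map \<zeta> a z = hp_affine \<zeta> 1 a z"
proof -
  have "hp_affine \<zeta> 1 a z = ((2 - a) * z + a * \<zeta>) / (- a * cnj \<zeta> * z + (2 + a))"
    by (simp add: hp_affine_def moebius_def algebra_simps)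
  then show ?thesis by (simp add: parabolic_map_def)
qed

text \<open>
  A Moebius map fixing \<open>\<zeta>\<close> with derivative 1 is a translation \<open>w \<mapsto> w + A\<close>. If \<open>Re A\<close> were negative, the
  point with coordinate \<open>w = - Re A\<close> would be sent to the boundary of the half-plane.
\<close>

lemma moebius_unit_multiplier:
  assumes \<zeta>: "cmod \<zeta> = 1" and self: "lin_frac_self_map \<phi>"
    and fx: "\<phi> \<zeta> = \<zeta>" and der: "deriv \<phi> \<zeta> = 1"
  obtains A where "\<And>z. \<phi> z = hp_affine \<zeta> 1 A z" "Re A \<ge> 0"
proof -
  have h: "\<zeta> * cnj \<zeta> = 1" using \<zeta> complex_norm_square[of \<zeta>] by simp
  have \<zeta>0: "\<zeta> \<noteq> 0" using \<zeta> by auto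
  obtain a b c d where \<phi>: "\<phi> = moebius a b c d" and nz: "\<And>z. z \<in> unit_disk \<Longrightarrow> c * z + d \<noteq> 0"
    and disk: "\<phi> ` unit_disk \<subseteq> unit_disk"
    using self unfolding lin_frac_self_map_def by blast
  define k where "k = c * \<zeta> + d"
  have k: "k \<noteq> 0"
    using fx \<zeta>0 by (auto simp: \<phi> moebius_def k_def)
  have 1: "a * \<zeta> + b = \<zeta> * k"
    using fx k by (simp add: \<phi> moebius_def k_def divide_eq_eq)
  have "(a * d - b * c) / k\<^sup>2 = 1"
    using DERIV_imp_deriv[OF moebius_has_field_derivative[of c \<zeta> d a b]] k der
    by (simp add: \<phi> k_def)
  then have 2: "a * d - b * c = k\<^sup>2" using k by (simp add: divide_eq_eq)
  have d: "d = k - c * \<zeta>" by (simp add: k_def)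
  have b: "b = \<zeta> * k - a * \<zeta>" using 1 by (simp add: eq_diff_eq add.commute)
  have "k * (a - (k + \<zeta> * c)) = 0" using 2 unfolding d b by algebra
  then have a: "a = k + \<zeta> * c" using k by simp
  define A where "A = - 2 * c * \<zeta> / k"
  have kA: "k * A = - 2 * c * \<zeta>" using k by (simp add: A_def)
  have N: "2 * (a * z + b) = k * ((2 - A) * z + A * \<zeta>)" for z
    using kA unfolding b a by algebra
  have D: "2 * (c * z + d) = k * (- A * cnj \<zeta> * z + (2 + A))" for z
    using kA h unfolding d by algebra
  have eq: "\<phi> z = hp_affine \<zeta> 1 A z" for z
  proof -
    have "\<phi> z = (2 * (a * z + b)) / (2 * (c * z + d))"
      unfolding \<phi> moebius_def by (simp only: mult_divide_mult_cancel_left_if) simp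
    also have "\<dots> = hp_affine \<zeta> 1 A z"
      unfolding N D parabolic_map_hp_affine[symmetric] parabolic_map_def using k by simp
    finally show ?thesis .
  qed
  have "Re A \<ge> 0"
  proof (rule ccontr)
    assume "\<not> Re A \<ge> 0"
    define e where "e = - Re A"
    have e: "e > 0" using \<open>\<not> Re A \<ge> 0\<close> by (simp add: e_def)
    define v where "v = (e - 1) / (e + 1)"
    have v: "\<bar>v\<bar> < 1" using e by (simp add: v_def abs_if field_simps)
    let ?z = "\<zeta> * of_real v"
    have z: "?z \<in> unit_disk" using v \<zeta> by (simp add: norm_mult)
    let ?D = "(of_real 1 - A - 1) * cnj \<zeta> * ?z + (of_real 1 + A + 1)"
    let ?N = "(of_real 1 - A + 1) * ?z + (of_real 1 + A - 1) * \<zeta>"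
    have "k * ?D = 2 * (c * ?z + d)" unfolding D by simp
    moreover have "2 * (c * ?z + d) \<noteq> 0"
      using nz[OF z] by (simp only: mult_eq_0_iff) simp
    ultimately have D0: "?D \<noteq> 0" by (metis mult_zero_right)
    have "\<phi> ?z \<in> unit_disk" using disk z by blast
    then have "cmod (?N / ?D) < 1"
      unfolding eq hp_affine_def moebius_def by simp
    then have "cmod ?N < cmod ?D" using D0 by (simp add: norm_divide divide_less_eq)
    then have "(cmod ?N)\<^sup>2 < (cmod ?D)\<^sup>2" by (rule power_strict_mono) auto
    then have "0 < (cmod ?D)\<^sup>2 - (cmod ?N)\<^sup>2" by (simp only: diff_gt_0_iff_gt)
    then have "0 < 4 * (1 * (1 - (cmod ?z)\<^sup>2) + Re A * (cmod (\<zeta> - ?z))\<^sup>2)"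
      unfolding hp_affine_boundary_identity[OF \<zeta>, of 1 A ?z] .
    then have "0 < 1 * (1 - (cmod ?z)\<^sup>2) + Re A * (cmod (\<zeta> - ?z))\<^sup>2"
      by (rule zero_less_mult_pos) simp
    moreover have "cmod ?z = \<bar>v\<bar>" using \<zeta> by (simp add: norm_mult)
    moreover have "cmod (\<zeta> - ?z) = 1 - v"
    proof -
      have "\<zeta> - ?z = \<zeta> * of_real (1 - v)" by (simp add: algebra_simps)
      then show ?thesis using \<zeta> v by (simp add: norm_mult del: of_real_diff)
    qed
    ultimately have "0 < 1 - v\<^sup>2 - e * (1 - v)\<^sup>2"
      by (simp add: e_def)
    moreover have "1 - v\<^sup>2 - e * (1 - v)\<^sup>2 = 0"
    proof -
      have ve: "v * (e + 1) = e - 1" using e by (simp add: v_def)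
      have "(1 - v\<^sup>2 - e * (1 - v)\<^sup>2) = (1 - v) * (1 - e + v * (e + 1))"
        by (simp add: power2_eq_square algebra_simps)
      then show ?thesis unfolding ve by simp
    qed
    ultimately show False by simp
  qed
  with eq show ?thesis by (rule that)
qed

lemma hp_affine_bij_betw:
  assumes \<zeta>: "cmod \<zeta> = 1" and b: "Re b = 0"
  shows "bij_betw (hp_affine \<zeta> 1 b) unit_disk unit_disk"
proof (rule bij_betw_byWitness[where f' = "hp_affine \<zeta> 1 (- b)"])
  have id: "hp_affine \<zeta> 1 0 z = z" for z
    by (simp add: hp_affine_def moebius_def)
  show "\<forall>z\<in>unit_disk. hp_affine \<zeta> 1 (- b) (hp_affine \<zeta> 1 b z) = z"
    using hp_affine_compose[OF \<zeta>, of 1 "- b" 1 b] b by (simp add: id)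
  show "\<forall>z\<in>unit_disk. hp_affine \<zeta> 1 b (hp_affine \<zeta> 1 (- b) z) = z"
    using hp_affine_compose[OF \<zeta>, of 1 b 1 "- b"] b by (simp add: id)
qed (use hp_affine_image[OF \<zeta>] b in auto)

lemma nonauto_unit_multiplier:
  assumes \<zeta>: "cmod \<zeta> = 1" and \<phi>: "lin_frac_nonauto \<phi>" "\<phi> \<zeta> = \<zeta>" "deriv \<phi> \<zeta> = 1"
  obtains a where "Re a > 0" "\<And>z. \<phi> z = parabolic_map \<zeta> a z"
proof -
  obtain a where a: "\<And>z. \<phi> z = hp_affine \<zeta> 1 a z" "Re a \<ge> 0"
    using moebius_unit_multiplier[OF \<zeta>, of \<phi>] \<phi> unfolding lin_frac_nonauto_def by blast
  then have "\<phi> = hp_affine \<zeta> 1 a" by auto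
  then have "Re a \<noteq> 0" using \<phi>(1) hp_affine_bij_betw[OF \<zeta>] unfolding lin_frac_nonauto_def by metis
  then show ?thesis using a that[of a] by (simp add: parabolic_map_hp_affine)
qed

text \<open>
  Maps that agree on the disk need not agree near \<open>\<zeta>\<close>, but difference quotients along the radius to
  \<open>\<zeta>\<close> already determine the derivative.
\<close>

lemma radial_derivative_unique:
  assumes \<zeta>: "cmod \<zeta> = 1"
    and f: "(f has_field_derivative f') (at \<zeta>)" and g: "(g has_field_derivative g') (at \<zeta>)"
    and eq: "\<And>z. z \<in> unit_disk \<Longrightarrow> f z = g z" "f \<zeta> = g \<zeta>"
  shows "f' = g'"
proof -
  have "((\<lambda>z. f z - g z) has_field_derivative f' - g') (at \<zeta>)"
    using f g by (rule DERIV_diff)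
  moreover define s where "s n = - \<zeta> * of_real (inverse (real (Suc n)))" for n
  have "s \<longlonglongrightarrow> - \<zeta> * of_real 0"
    unfolding s_def by (intro tendsto_mult tendsto_const tendsto_of_real LIMSEQ_inverse_real_of_nat)
  then have "s \<longlonglongrightarrow> 0" by simp
  moreover have "s n \<noteq> 0" for n
    using \<zeta> by (auto simp: s_def simp del: of_nat_Suc)
  moreover have "(\<lambda>n. ((f (\<zeta> + s n) - g (\<zeta> + s n)) - (f \<zeta> - g \<zeta>)) / s n) \<longlonglongrightarrow> 0"
  proof -
    have "\<zeta> + s n \<in> unit_disk" for n
    proof -
      have "\<zeta> + s n = \<zeta> * of_real (1 - inverse (real (Suc n)))" by (simp add: s_def algebra_simps)
      then have "cmod (\<zeta> + s n) = \<bar>1 - inverse (real (Suc n))\<bar>"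
        using \<zeta> by (simp add: norm_mult del: of_real_diff)
      also have "\<dots> < 1" by (simp add: abs_if field_simps)
      finally show ?thesis by simp
    qed
    then show ?thesis using eq by simp
  qed
  ultimately have "f' - g' = 0" by (rule field_derivative_lim_unique)
  then show ?thesis by simp
qed

text \<open>
  Membership in \<open>P_ops\<close> is a property of the operator, and derivative 1 is a property of a symbol. They
  match because an operator determines its symbol on the disk, as the image of the function \<open>z\<close>.
\<close>

lemma nonparabolic_F_ops:
  assumes \<zeta>: "cmod \<zeta> = 1"
  shows "F_ops \<zeta> - P_ops \<zeta> =
    {T. \<exists>\<phi>. lin_frac_nonauto \<phi> \<and> \<phi> \<zeta> = \<zeta> \<and> deriv \<phi> \<zeta> \<noteq> 1 \<and> is_composition_op \<phi> T}" (is "?L = ?R")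
proof
  show "?L \<subseteq> ?R"
  proof
    fix T assume T: "T \<in> ?L"
    then obtain \<phi> where \<phi>: "lin_frac_nonauto \<phi>" "\<phi> \<zeta> = \<zeta>" "is_composition_op \<phi> T"
      by (auto simp: F_ops_def)
    have "deriv \<phi> \<zeta> \<noteq> 1"
    proof
      assume "deriv \<phi> \<zeta> = 1"
      from nonauto_unit_multiplier[OF \<zeta> \<phi>(1,2) this]
      obtain a where "Re a > 0" "\<And>z. \<phi> z = parabolic_map \<zeta> a z" by blast
      then have "T \<in> P_ops \<zeta>" using \<phi>(3) unfolding P_ops_def is_composition_op_def by auto
      with T show False by simp
    qed
    with \<phi> show "T \<in> ?R" by blast
  qed
  show "?R \<subseteq> ?L"
  proof
    fix T assume "T \<in> ?R"
    then obtain \<phi> where \<phi>: "lin_frac_nonauto \<phi>" "\<phi> \<zeta> = \<zeta>" "deriv \<phi> \<zeta> \<noteq> 1" "is_composition_op \<phi> T"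
      by blast
    have "T \<notin> P_ops \<zeta>"
    proof
      assume "T \<in> P_ops \<zeta>"
      then obtain a where a: "Re a > 0" "is_composition_op (hp_affine \<zeta> 1 a) T"
        by (auto simp: P_ops_def is_composition_op_def parabolic_map_hp_affine)
      have eq: "\<phi> z = hp_affine \<zeta> 1 a z" if z: "z \<in> unit_disk" for z
      proof -
        have "\<phi> z \<in> unit_disk"
          using \<phi>(1) z unfolding lin_frac_nonauto_def lin_frac_self_map_def by blast
        moreover have "hp_affine \<zeta> 1 a z \<in> unit_disk"
          using hp_affine_in_disk[OF \<zeta> _ _ z, of 1 a] a(1) by simp
        ultimately show ?thesis
          using composition_op_monom[OF \<phi>(4) z, of 1] composition_op_monom[OF a(2) z, of 1] by simp
      qed
      obtain p q r s where m: "\<phi> = moebius p q r s"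
        using \<phi>(1) unfolding lin_frac_nonauto_def lin_frac_self_map_def by blast
      have "r * \<zeta> + s \<noteq> 0" using \<phi>(2) \<zeta> by (auto simp: m moebius_def)
      from moebius_has_field_derivative[OF this, of p q]
      have d: "(\<phi> has_field_derivative deriv \<phi> \<zeta>) (at \<zeta>)"
        unfolding m by (metis DERIV_imp_deriv)
      have "deriv \<phi> \<zeta> = 1 / of_real 1"
        by (rule radial_derivative_unique[OF \<zeta> d hp_affine_deriv[OF \<zeta>]])
           (use eq \<phi>(2) hp_affine_fixes[OF \<zeta>] in auto)
      with \<phi>(3) show False by simp
    qed
    with \<phi> show "T \<in> ?L" unfolding F_ops_def by blast
  qed
qed

section \<open>The two algebras coincide\<close>

text \<open>
  A translation \<open>w \<mapsto> w + a\<close> is \<open>w \<mapsto> t w + (1 - t)\<close> followed by \<open>w \<mapsto> w / t + c\<close>. The choice of \<open>t\<close> with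
  \<open>1 / t = 1 + Re a / 2\<close> leaves \<open>c = a - Re a / 2\<close>, whose real part is still positive.
\<close>

lemma P_ops_factor:
  assumes \<zeta>: "cmod \<zeta> = 1" and T: "T \<in> P_ops \<zeta>"
  obtains R S where "R \<in> F_ops \<zeta> - P_ops \<zeta>" "S \<in> F_ops \<zeta> - P_ops \<zeta>" "T = R o\<^sub>L S"
proof -
  obtain a where a: "Re a > 0" "is_composition_op (hp_affine \<zeta> 1 a) T"
    using T by (auto simp: P_ops_def is_composition_op_def parabolic_map_hp_affine)
  define t where "t = 2 / (2 + Re a)"
  have t: "0 < t" "t < 1" "1 / t = 1 + Re a / 2" using a(1) by (auto simp: t_def field_simps)
  define b :: complex where "b = of_real (1 - t)"
  define c :: complex where "c = a - of_real (Re a / 2)"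
  have bc: "Re b > 0" "Re c > 0" using t a(1) by (auto simp: b_def c_def)
  obtain R where R: "is_composition_op (hp_affine \<zeta> t b) R" using hp_affine_op[OF \<zeta> t(1), of b] bc by auto
  have t': "1 / t > 0" using t(1) by simp
  obtain S where S: "is_composition_op (hp_affine \<zeta> (1 / t) c) S"
    using hp_affine_op[OF \<zeta> t', of c] bc by auto
  have mem: "U \<in> F_ops \<zeta> - P_ops \<zeta>"
    if "is_composition_op (hp_affine \<zeta> s e) U" "s > 0" "s \<noteq> 1" "Re e > 0" for s e U
  proof -
    have "deriv (hp_affine \<zeta> s e) \<zeta> = 1 / of_real s"
      by (rule DERIV_imp_deriv[OF hp_affine_deriv[OF \<zeta> that(2)]])
    also have "\<dots> \<noteq> 1" using that by (simp add: divide_eq_1_iff)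
    finally show ?thesis
      unfolding nonparabolic_F_ops[OF \<zeta>]
      using that hp_affine_nonauto[OF \<zeta> that(2,4)] hp_affine_fixes[OF \<zeta> that(2)] by blast
  qed
  have "T = R o\<^sub>L S"
  proof (rule composition_op_unique[OF a(2) composition_op_compose[OF R S]])
    show "hp_affine \<zeta> t b ` unit_disk \<subseteq> unit_disk" using hp_affine_image[OF \<zeta> t(1)] bc by simp
    fix z assume z: "z \<in> unit_disk"
    have "hp_affine \<zeta> (1 / t) c (hp_affine \<zeta> t b z) = hp_affine \<zeta> (1 / t * t) (of_real (1 / t) * b + c) z"
      by (rule hp_affine_compose[OF \<zeta>]) (use t(1,2) bc z in auto)
    also have "1 / t * t = 1" using t(1) by simp
    also have "of_real (1 / t) * b + c = a"
    proof -
      have "1 / t * (1 - t) = 1 / t - 1" using t(1) by (simp add: right_diff_distrib)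
      also have "\<dots> = Re a / 2" using t(3) by simp
      finally have "1 / t * (1 - t) = Re a / 2" .
      then have "of_real (1 / t) * b = complex_of_real (Re a / 2)"
        unfolding b_def by (metis of_real_mult)
      then show ?thesis by (simp add: c_def)
    qed
    finally show "hp_affine \<zeta> 1 a z = (hp_affine \<zeta> (1 / t) c \<circ> hp_affine \<zeta> t b) z" by simp
  qed
  moreover have "R \<in> F_ops \<zeta> - P_ops \<zeta>"
    by (rule mem[OF R]) (use t(1,2) bc in auto)
  moreover have "S \<in> F_ops \<zeta> - P_ops \<zeta>"
    by (rule mem[OF S t' _ bc(2)]) (use t(1,2) in simp)
  ultimately show ?thesis using that by blast
qed

theorem mainTheorem2:
  fixes \<zeta> :: complex
  assumes "\<zeta> \<in> sphere 0 1"
  shows "cstar_gen (F_ops \<zeta>) = cstar_gen ((F_ops \<zeta> - P_ops \<zeta>) \<union> compact_ops) \<and>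
         cstar_gen ((F_ops \<zeta> - P_ops \<zeta>) \<union> compact_ops) =
         cstar_gen (compact_ops \<union>
           {T. \<exists>\<phi>. lin_frac_nonauto \<phi> \<and> \<phi> \<zeta> = \<zeta> \<and> deriv \<phi> \<zeta> \<noteq> 1 \<and> is_composition_op \<phi> T})"
proof
  have \<zeta>: "cmod \<zeta> = 1" using assms by simp
  \<comment> \<open>Both generated algebras are intersections over the same family of C*-algebras.\<close>
  have "F_ops \<zeta> \<subseteq> A \<longleftrightarrow> (F_ops \<zeta> - P_ops \<zeta>) \<union> compact_ops \<subseteq> A" if A: "unital_cstar_algebra A" for A
  proof
    assume "F_ops \<zeta> \<subseteq> A"
    then show "(F_ops \<zeta> - P_ops \<zeta>) \<union> compact_ops \<subseteq> A"
      using compact_ops_subset_cstar[OF A \<zeta>] by blast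
  next
    assume sub: "(F_ops \<zeta> - P_ops \<zeta>) \<union> compact_ops \<subseteq> A"
    have "T \<in> A" if "T \<in> P_ops \<zeta>" for T
      using P_ops_factor[OF \<zeta> that] cstar_compose[OF A] sub by (metis Un_iff subsetD)
    with sub show "F_ops \<zeta> \<subseteq> A" by blast
  qed
  then show "cstar_gen (F_ops \<zeta>) = cstar_gen ((F_ops \<zeta> - P_ops \<zeta>) \<union> compact_ops)"
    unfolding cstar_gen_def by (intro arg_cong[where f = Inter] Collect_cong) blast
  show "cstar_gen ((F_ops \<zeta> - P_ops \<zeta>) \<union> compact_ops) =
         cstar_gen (compact_ops \<union>
           {T. \<exists>\<phi>. lin_frac_nonauto \<phi> \<and> \<phi> \<zeta> = \<zeta> \<and> deriv \<phi> \<zeta> \<noteq> 1 \<and> is_composition_op \<phi> T})"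
    unfolding nonparabolic_F_ops[OF \<zeta>] by (simp only: Un_commute)
qed

end
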